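(* Let $x^*\in\mathbb{R}^p$ with $F(x^* )=0$, let $x^0\in\mathbb{R}^p$, and let $L=\sup_{\|x-x^*\|\le\|x^0-x^*\|}\|DF(x)\|>0$. Define $$\rho(x)=\min_{v\in\mathrm{Im}(DF(x))\setminus\{0\}}\frac{v^\top DF(x)\,\mathbb{E}[\mathbf{H}_{\mathbf{S}}(x)]\,DF(x)^\top v}{\|v\|^2},\qquad \rho=\min_{x:\ \|x-x^*\|\le\|x^0-x^*\|}\rho(x).$$ Then $0\le\rho(x)\le1$. If $$F(x)\in\mathrm{Im}(DF(x)^\top)\subset\mathrm{Im}(\mathbb{E}[\mathbf{H}_{\mathbf{S}}(x)])\quad\text{for all }x\in\mathbb{R}^p,$$ then $$\rho(x)=\lambda^+_{\min}\big(DF(x)\,\mathbb{E}[\mathbf{H}_{\mathbf{S}}(x)]\,DF(x)^\top\big)>0\quad\forall x\in\mathbb{R}^p,\qquad\text{and}\qquad \rho>0,$$ where $\lambda^+_{\min}$ is the smallest non-zero eigenvalue. Furthermore, if in addition, along the iterates $x^k$ of the Sketched Newton-Raphson (SNR) method started at $x^0$ with stepsize $0<\gamma<1$, for every $k$ and all $\mathbf{S}_k\sim\mathcal{D}_{x^k}$, $$f_{\mathbf{S}_k,x^k}(x^* )\ge f_{\mathbf{S}_k,x^k}(x^k)+\langle\nabla f_{\mathbf{S}_k,x^k}(x^k),x^*-x^k\rangle,$$ then for every $k\ge1$ $$\mathbb{E}\Big[\min_{t=0,\dots,k-1}\|F(x^t)\|^2\Big]\le\frac1k\cdot\frac{L^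2\|x^0-x^*\|^2}{\rho\,\gamma(1-\gamma)}.$$
   Context: $F:\mathbb{R}^p\to\mathbb{R}^m$ is continuously differentiable, and $DF(x)=[\nabla F_1(x)\ \cdots\ \nabla F_m(x)]\in\mathbb{R}^{p\times m}$ is the transpose of its Jacobian. For each $x\in\mathbb{R}^p$, $\mathcal{D}_x$ is a probability distribution over sketching matrices $\mathbf{S}\in\mathbb{R}^{m\times\tau}$. $\dagger$ denotes the Moore-Penrose pseudoinverse and $$\mathbf{H}_{\mathbf{S}}(x)=\mathbf{S}\big(\mathbf{S}^\top DF(x)^\top DF(x)\mathbf{S}\big)^\dagger\mathbf{S}^\top\in\mathbb{R}^{m\times m};$$ $\mathbb{E}[\mathbf{H}_{\mathbf{S}}(x)]$ is its expectation over $\mathbf{S}\sim\mathcal{D}_x$, understood to be finite. $\mathrm{Im}$ denotes the image (column space), $\|\cdot\|$ the Euclidean norm for vectors and the induced operator norm for matrices. The minima defining $\rho(x)$ and $\rho$ are understood to exist (in particular $\mathrm{Im}(DF(x))\ne\{0\}$ where $\rho(x)$ is used). Define $f_{\mathbf{S},y}(x)=\tfrac12F(x)^\top\mathbf{H}_{\mathbf{S}}(y)F(x)$, with gradient in $x$ (for $y,\mathbf{S}$ fixed) $\nabla f_{\mathbf{S},y}(x)=DF(x)\mathbf{H}_{\mathbf{S}}(y)F(x)$. SNR method: given a deterministic $x^0$ and stepsize $\gamma>0$, at each $k\ge0$ sample a fresh $\mathbf{S}_k\sim\mathcal{D}_{x^k}$ (conditionally on $x^k$) and set $$x^{k+1}=x^k-\gamma\,DF(x^k)\mathbf{S}_k\big(\mathbf{S}_k^\top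 DF(x^k)^\top DF(x^k)\mathbf{S}_k\big)^\dagger\mathbf{S}_k^\top F(x^k).$$ *)

theory Defs
  imports "HOL-Analysis.Analysis" "HOL-Probability.Probability"
begin

text \<open>
  An \<open>a \<times> b\<close> matrix has type \<open>real ^ 'b ^ 'a\<close> (the row index is the outer one). Thus
  \<open>DF F x\<close> is \<open>p \<times> m\<close>, and a sketching matrix \<open>S\<close> of type \<open>real ^ 't ^ 'm\<close> is \<open>m \<times> \<tau>\<close>.
\<close>

definition DF :: "(real ^ 'p \<Rightarrow> real ^ 'm) \<Rightarrow> real ^ 'p \<Rightarrow> real ^ 'm ^ 'p" where
  "DF F x = transpose (jacobian F (at x))"

definition continuously_differentiable :: "(real ^ 'p \<Rightarrow> real ^ 'm) \<Rightarrow> bool" where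
  "continuously_differentiable F \<longleftrightarrow>
     (\<forall>x. F differentiable (at x)) \<and> continuous_on UNIV (DF F)"

definition col_space :: "real ^ 'n ^ 'k \<Rightarrow> (real ^ 'k) set" where
  "col_space A = range ((*v) A)"

text \<open>The four Penrose equations, which have exactly one solution \<open>B\<close> for every real \<open>A\<close>.\<close>

definition is_pinv :: "real ^ 'n ^ 'k \<Rightarrow> real ^ 'k ^ 'n \<Rightarrow> bool" where
  "is_pinv A B \<longleftrightarrow>
     A ** B ** A = A \<and> B ** A ** B = B \<and>
     transpose (A ** B) = A ** B \<and> transpose (B ** A) = B ** A"

definition pinv :: "real ^ 'n ^ 'k \<Rightarrow> real ^ 'k ^ 'n" where
  "pinv A = (THE B. is_pinv A B)"

definition eigval :: "real ^ 'n ^ 'n \<Rightarrow> real \<Rightarrow> bool" where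
  "eigval A l \<longleftrightarrow> (\<exists>v. v \<noteq> 0 \<and> A *v v = l *\<^sub>R v)"

definition lambda_min_pos :: "real ^ 'n ^ 'n \<Rightarrow> real" where
  "lambda_min_pos A = (LEAST l. eigval A l \<and> l \<noteq> 0)"

definition grad :: "('a :: real_inner \<Rightarrow> real) \<Rightarrow> 'a \<Rightarrow> 'a" where
  "grad f x = (THE d. GDERIV f x :> d)"

definition sketch_H :: "(real ^ 'p \<Rightarrow> real ^ 'm) \<Rightarrow> real ^ 't ^ 'm \<Rightarrow> real ^ 'p \<Rightarrow> real ^ 'm ^ 'm" where
  "sketch_H F S x =
     S ** pinv (transpose S ** transpose (DF F x) ** DF F x ** S) ** transpose S"

definition expected_H :: "(real ^ 'p \<Rightarrow> real ^ 'm) \<Rightarrow> (real ^ 'p \<Rightarrow> (real ^ 't ^ 'm) measure)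
    \<Rightarrow> real ^ 'p \<Rightarrow> real ^ 'm ^ 'm" where
  "expected_H F D x = (\<integral>S. sketch_H F S x \<partial>D x)"

definition sketched_obj :: "(real ^ 'p \<Rightarrow> real ^ 'm) \<Rightarrow> real ^ 't ^ 'm \<Rightarrow> real ^ 'p
    \<Rightarrow> real ^ 'p \<Rightarrow> real" where
  "sketched_obj F S y x = 1 / 2 * (F x \<bullet> (sketch_H F S y *v F x))"

text \<open>
  \<open>Least\<close> on the reals is the minimum whenever it exists and is unspecified otherwise.
  For \<open>rho_at\<close> the minimum exists iff \<open>col_space (DF F x) \<noteq> {0}\<close>.
\<close>

definition rho_at :: "(real ^ 'p \<Rightarrow> real ^ 'm) \<Rightarrow> (real ^ 'p \<Rightarrow> (real ^ 't ^ 'm) measure)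
    \<Rightarrow> real ^ 'p \<Rightarrow> real" where
  "rho_at F D x =
     (LEAST r. \<exists>v \<in> col_space (DF F x) - {0}.
        r = v \<bullet> ((DF F x ** expected_H F D x ** transpose (DF F x)) *v v) / (norm v)\<^sup>2)"

definition rho :: "(real ^ 'p \<Rightarrow> real ^ 'm) \<Rightarrow> (real ^ 'p \<Rightarrow> (real ^ 't ^ 'm) measure)
    \<Rightarrow> real ^ 'p \<Rightarrow> real ^ 'p \<Rightarrow> real" where
  "rho F D xs x0 = (LEAST r. \<exists>x. norm (x - xs) \<le> norm (x0 - xs) \<and> r = rho_at F D x)"

primrec SNR_iter :: "(real ^ 'p \<Rightarrow> real ^ 'm) \<Rightarrow> real \<Rightarrow> real ^ 'p \<Rightarrow> (nat \<Rightarrow> real ^ 't ^ 'm)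
    \<Rightarrow> nat \<Rightarrow> real ^ 'p" where
  "SNR_iter F \<gamma> x0 S 0 = x0"
| "SNR_iter F \<gamma> x0 S (Suc k) =
     (let x = SNR_iter F \<gamma> x0 S k in
      x - \<gamma> *\<^sub>R ((DF F x ** S k **
        pinv (transpose (S k) ** transpose (DF F x) ** DF F x ** S k) ** transpose (S k)) *v F x))"

text \<open>
  The \<open>\<sigma>\<close>-algebra on the sample space generated by the first \<open>k\<close> sketches;
  the \<open>k\<close>-th iterate is a function of these.
\<close>

definition history :: "'w measure \<Rightarrow> (nat \<Rightarrow> 'w \<Rightarrow> real ^ 't ^ 'm) \<Rightarrow> nat \<Rightarrow> 'w measure" where
  "history M S k =
     vimage_algebra (space M) (\<lambda>\<omega>. \<lambda>j\<in>{..<k}. S j \<omega>) (\<Pi>\<^sub>M j\<in>{..<k}. borel)"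

text \<open>
  The random sketches \<open>S 0, S 1, \<dots>\<close> drive the SNR method: given the past, the law of \<open>S k\<close> is
  \<open>D\<close> at the \<open>k\<close>-th iterate, i.e. \<open>P(S k \<in> A | S 0, \<dots>, S (k - 1)) = D (x k) A\<close> almost surely.
  The measurability of \<open>D\<close> says that \<open>D\<close> is a Markov kernel.
\<close>

definition SNR_sketches :: "(real ^ 'p \<Rightarrow> real ^ 'm) \<Rightarrow> (real ^ 'p \<Rightarrow> (real ^ 't ^ 'm) measure)
    \<Rightarrow> real \<Rightarrow> real ^ 'p \<Rightarrow> 'w measure \<Rightarrow> (nat \<Rightarrow> 'w \<Rightarrow> real ^ 't ^ 'm) \<Rightarrow> bool" where
  "SNR_sketches F D \<gamma> x0 M S \<longleftrightarrow>
     prob_space M \<and>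
     D \<in> borel \<rightarrow>\<^sub>M prob_algebra borel \<and>
     (\<forall>k. S k \<in> borel_measurable M) \<and>
     (\<forall>k. \<forall>A \<in> sets borel. AE \<omega> in M.
        real_cond_exp M (history M S k) (indicator (S k -` A \<inter> space M)) \<omega> =
        measure (D (SNR_iter F \<gamma> x0 (\<lambda>j. S j \<omega>) k)) A)"

end

theory Submission
  imports Defs
begin

text \<open>
  Since \<open>H\<^sub>S DF\<^sup>T DF H\<^sub>S = H\<^sub>S\<close>, the step direction \<open>g = DF H\<^sub>S F\<close> satisfies
  \<open>\<parallel>g\<parallel>\<^sup>2 = F\<^sup>T H\<^sub>S F = 2 f\<close>, and the star-convexity hypothesis gives
  \<open>\<parallel>x\<^sup>k\<^sup>+\<^sup>1 - x\<^sup>*\<parallel>\<^sup>2 \<le> \<parallel>x\<^sup>k - x\<^sup>*\<parallel>\<^sup>2 - \<gamma> (1 - \<gamma>) F\<^sup>T H\<^sub>S F\<close>. The iterates therefore stay in the ball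
  around \<open>x\<^sup>*\<close> and the terms \<open>F\<^sup>T H\<^sub>S F\<close> are summable. Conditioning on the past replaces \<open>H\<^sub>S\<close>
  by its mean \<open>E\<close>; writing \<open>F = DF\<^sup>T w\<close> with \<open>w\<close> in the image of \<open>DF\<close> yields
  \<open>F\<^sup>T E F \<ge> \<rho> \<parallel>w\<parallel>\<^sup>2 \<ge> \<rho> \<parallel>F\<parallel>\<^sup>2 / L\<^sup>2\<close>. The value \<open>\<rho>(x)\<close> is the least Rayleigh quotient of the
  symmetric matrix \<open>DF E DF\<^sup>T\<close> on its invariant subspace \<open>Im DF\<close>, hence an eigenvalue; it is nonzero
  because \<open>E\<close> is positive definite on its image.
\<close>

section \<open>The pseudoinverse of a symmetric matrix\<close>

lemma inner_matrix_vector_mult: "x \<bullet> (A *v y) = (transpose A *v x) \<bullet> y"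
  for A :: "real ^ 'n ^ 'm"
  by (simp add: dot_lmul_matrix)

lemma transpose_diff: "transpose (A - B) = transpose A - transpose B"
  by (simp add: transpose_def vec_eq_iff)

lemma matrix_add_rdistrib: "(A + B) ** C = A ** C + B ** C"
  for A B :: "real ^ 'n ^ 'm"
  by (simp add: matrix_eq matrix_vector_mult_add_rdistrib flip: matrix_vector_mul_assoc)

lemma matrix_diff_ldistrib: "A ** (B - C) = A ** B - A ** C"
  for A :: "real ^ 'n ^ 'm"
  by (simp add: matrix_eq matrix_vector_mult_diff_distrib matrix_vector_mult_diff_rdistrib
      flip: matrix_vector_mul_assoc)

lemma matrix_diff_rdistrib: "(A - B) ** C = A ** C - B ** C"
  for A B :: "real ^ 'n ^ 'm"
  by (simp add: matrix_eq matrix_vector_mult_diff_rdistrib flip: matrix_vector_mul_assoc)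

text \<open>A zero of the form minimises it on \<open>V\<close>, so the first-order condition applies.\<close>

lemma psd_form_eq_0_imp:
  fixes f :: "'a::real_inner \<Rightarrow> 'a"
  assumes f: "linear f" and V: "subspace V" "f ` V \<subseteq> V"
    and sym: "\<And>x y. x \<in> V \<Longrightarrow> y \<in> V \<Longrightarrow> x \<bullet> f y = f x \<bullet> y"
    and psd: "\<And>x. x \<in> V \<Longrightarrow> 0 \<le> x \<bullet> f x"
    and v: "v \<in> V" "v \<bullet> f v = 0"
  shows "f v = 0"
proof -
  interpret f: linear f by fact
  define a where "a = f v \<bullet> f v"
  define b where "b = f v \<bullet> f (f v)"
  have w: "f v \<in> V" using v V by auto
  have b: "0 \<le> b" using psd[OF w] by (simp add: b_def)
  \<comment> \<open>At \<open>v + t *\<^sub>R f v\<close> the form equals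
    \<open>2 * t * a + t\<^sup>2 * b\<close>, which \<open>- a / b\<close> would minimise. The
    denominator \<open>b + 1\<close> avoids division by zero and still makes the value negative
    unless \<open>a = 0\<close>.\<close>
  define t where "t = - a / (b + 1)"
  have "v + t *\<^sub>R f v \<in> V"
    using v(1) w V(1) by (simp add: subspace_add subspace_scale)
  from psd[OF this] have "0 \<le> 2 * t * a + t\<^sup>2 * b"
    using v(2) sym[OF v(1) w]
    by (simp add: f.add f.scale inner_simps a_def b_def power2_eq_square algebra_simps)
  then have "0 \<le> (b + 1)\<^sup>2 * (2 * t * a + t\<^sup>2 * b)" by simp
  also have "\<dots> = 2 * (t * (b + 1)) * a * (b + 1) + (t * (b + 1))\<^sup>2 * b"
    by (simp add: power2_eq_square algebra_simps)
  also have "t * (b + 1) = - a" using b by (simp add: t_def)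
  also have "2 * (- a) * a * (b + 1) + (- a)\<^sup>2 * b = - (a\<^sup>2 * (b + 2))"
    by (simp add: power2_eq_square algebra_simps)
  finally have "a\<^sup>2 * (b + 2) \<le> 0" by simp
  with b have "a\<^sup>2 \<le> 0"
    by (simp add: mult_le_0_iff)
  then show ?thesis by (simp add: a_def)
qed

text \<open>The projection is the sum of \<open>(x \<bullet> b) *\<^sub>R b\<close> over an
  orthonormal basis of \<open>V\<close>. It serves twice: to construct a pseudoinverse, and to move
  preimages into a column space.\<close>

lemma exists_orthogonal_projection_matrix:
  fixes V :: "(real ^ 'n) set"
  assumes "subspace V"
  obtains P :: "real ^ 'n ^ 'n" where "transpose P = P" "\<And>x. P *v x \<in> V"
    "\<And>x. x \<in> V \<Longrightarrow> P *v x = x"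
proof -
  obtain B where B: "B \<subseteq> V" "pairwise orthogonal B" "\<And>x. x \<in> B \<Longrightarrow> norm x = 1"
     "independent B" "card B = dim V" "span B = V"
    using orthonormal_basis_subspace[OF assms] by metis
  have fin: "finite B" using B(4) independent_imp_finite by blast
  define f where "f x = (\<Sum>b\<in>B. (x \<bullet> b) *\<^sub>R b)" for x
  have lin: "linear f"
    unfolding f_def by (intro linear_compose_sum ballI linearI) (auto simp: inner_simps algebra_simps)
  have app: "matrix f *v x = f x" for x
    using lin by (simp add: matrix_works)
  have sym: "f x \<bullet> y = x \<bullet> f y" for x y
    by (simp add: f_def inner_sum_left inner_sum_right inner_commute mult.commute)
  have mem: "f x \<in> V" for x
    unfolding f_def B(6)[symmetric]
    by (intro span_sum span_mul span_base)
  have fix_basis: "f x = x" if "x \<in> B" for x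
  proof -
    have "f x = (\<Sum>b\<in>B. if b = x then x else 0)"
      unfolding f_def
    proof (rule sum.cong)
      fix b assume "b \<in> B"
      then show "(x \<bullet> b) *\<^sub>R b = (if b = x then x else 0)"
        using that B(2,3) by (auto simp: pairwise_def orthogonal_def dot_square_norm)
    qed simp
    then show ?thesis using that fin by simp
  qed
  have "f x = x" if "x \<in> V" for x
    using linear_eq_on[OF lin linear_ident, of x B] fix_basis that B(6) by simp
  moreover have "transpose (matrix f) = matrix f"
  proof -
    have "transpose (matrix f) *v y = matrix f *v y" for y
    proof (rule vector_eq_rdot[THEN iffD1], rule allI)
      fix z
      show "(transpose (matrix f) *v y) \<bullet> z = (matrix f *v y) \<bullet> z"
        unfolding inner_matrix_vector_mult[symmetric] app by (simp add: sym)
    qed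
    then show ?thesis by (simp add: matrix_eq)
  qed
  ultimately show ?thesis using that[of "matrix f"] app mem by simp
qed

text \<open>Penrose's argument: the symmetric matrices \<open>A ** B\<close> and
  \<open>A ** C\<close> absorb each other, so transposing their product shows that they agree. The
  same holds for \<open>B ** A\<close> and \<open>C ** A\<close>, and then
  \<open>B = B ** A ** B = C ** A ** C = C\<close>.\<close>

lemma is_pinv_unique:
  assumes B: "is_pinv A B" and C: "is_pinv A C"
  shows "B = C"
proof -
  have "A ** B = transpose ((A ** C) ** (A ** B))"
    using B C unfolding is_pinv_def by (metis matrix_mul_assoc)
  also have "\<dots> = (A ** B) ** (A ** C)"
    using B C unfolding is_pinv_def by (simp add: matrix_transpose_mul)
  also have "\<dots> = A ** C"
    using B unfolding is_pinv_def by (metis matrix_mul_assoc)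
  finally have AB: "A ** B = A ** C" .
  have "B ** A = transpose ((B ** A) ** (C ** A))"
    using B C unfolding is_pinv_def by (metis matrix_mul_assoc)
  also have "\<dots> = (C ** A) ** (B ** A)"
    using B C unfolding is_pinv_def by (simp add: matrix_transpose_mul)
  also have "\<dots> = C ** A"
    using B unfolding is_pinv_def by (metis matrix_mul_assoc)
  finally have BA: "B ** A = C ** A" .
  have "B = B ** (A ** B)" using B unfolding is_pinv_def by (metis matrix_mul_assoc)
  also have "\<dots> = C ** A ** C" by (metis AB BA matrix_mul_assoc)
  also have "\<dots> = C" using C unfolding is_pinv_def by simp
  finally show ?thesis .
qed

text \<open>With \<open>P\<close> the orthogonal projection onto the kernel of \<open>G\<close>, the matrix \<open>G + P\<close>
  is invertible and the pseudoinverse is its inverse minus \<open>P\<close>.\<close>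

lemma symmetric_matrix_exists_pinv:
  fixes G :: "real ^ 'n ^ 'n"
  assumes G: "transpose G = G"
  obtains B where "is_pinv G B"
proof -
  define V where "V = {x. G *v x = 0}"
  have V: "subspace V"
    unfolding V_def subspace_def by (auto simp: matrix_vector_right_distrib matrix_vector_mult_scaleR)
  obtain P :: "real ^ 'n ^ 'n" where P: "transpose P = P" "\<And>x. P *v x \<in> V"
    "\<And>x. x \<in> V \<Longrightarrow> P *v x = x" using exists_orthogonal_projection_matrix[OF V] by blast
  have GP: "G ** P = 0"
    using P(2) by (simp add: V_def matrix_eq flip: matrix_vector_mul_assoc)
  have PG: "P ** G = 0"
    using arg_cong[OF GP, of transpose] by (simp add: matrix_transpose_mul G P(1)) (simp add: transpose_def vec_eq_iff)
  have PP: "P ** P = P"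
    using P(2,3) by (simp add: matrix_eq flip: matrix_vector_mul_assoc)
  define M where "M = G + P"
  have "x = 0" if "M *v x = 0" for x
  proof -
    \<comment> \<open>Multiplying \<open>M *v x = 0\<close> by \<open>G\<close> removes
      \<open>P\<close>, and symmetry of \<open>G\<close> turns \<open>(G ** G) *v x = 0\<close> into
      \<open>G *v x = 0\<close>. So \<open>x\<close> lies in \<open>V\<close>, where
      \<open>M\<close> acts as the identity.\<close>
    have "G ** M = G ** G" by (simp add: M_def matrix_add_ldistrib GP)
    then have "(G ** G) *v x = 0" using that by (metis matrix_vector_mul_assoc matrix_vector_mult_0_right)
    then have "(G *v x) \<bullet> (G *v x) = 0"
      unfolding inner_matrix_vector_mult G by (simp add: matrix_vector_mul_assoc)
    then have "x \<in> V" by (simp add: V_def)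
    then have "M *v x = x" by (simp add: M_def matrix_vector_mult_add_rdistrib P(3)) (simp add: V_def)
    with that show ?thesis by simp
  qed
  then obtain K where KM: "K ** M = mat 1"
    using matrix_left_invertible_ker[of M] by blast
  then have MK: "M ** K = mat 1" using matrix_left_right_inverse by blast
  have MP: "M ** P = P" "P ** M = P"
    by (simp_all add: M_def matrix_add_ldistrib matrix_add_rdistrib GP PG PP)
  have KP: "K ** P = P" by (metis KM MP(1) matrix_mul_assoc matrix_mul_lid)
  have PK: "P ** K = P" by (metis MK MP(2) matrix_mul_assoc matrix_mul_rid)
  have Geq: "G = M - P" by (simp add: M_def)
  have GB: "G ** (K - P) = mat 1 - P" "(K - P) ** G = mat 1 - P"
    by (simp_all add: Geq matrix_diff_ldistrib matrix_diff_rdistrib MK KM KP PK MP PP)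
  have "transpose (mat 1 - P) = mat 1 - P"
    by (simp add: transpose_diff P(1))
  then have "is_pinv G (K - P)"
    unfolding is_pinv_def GB
    by (simp add: matrix_diff_ldistrib matrix_diff_rdistrib PG KP PK PP)
  then show ?thesis by (rule that)
qed

text \<open>The transpose of a pseudoinverse of a symmetric \<open>G\<close> solves the Penrose
  equations for \<open>G\<close> as well, so uniqueness makes it symmetric. Symmetry of
  \<open>G ** pinv G\<close> then says that the two factors commute.\<close>

lemma pinv_symmetric:
  fixes G :: "real ^ 'n ^ 'n"
  assumes G: "transpose G = G"
  shows "is_pinv G (pinv G)" and "transpose (pinv G) = pinv G" and "G ** pinv G = pinv G ** G"
proof -
  show pinv: "is_pinv G (pinv G)"
    unfolding pinv_def
    by (metis (mono_tags, lifting) symmetric_matrix_exists_pinv[OF G] is_pinv_unique theI)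
  have "is_pinv G (transpose (pinv G))"
    using pinv unfolding is_pinv_def by (metis G matrix_transpose_mul matrix_mul_assoc)
  then show sym: "transpose (pinv G) = pinv G"
    using pinv is_pinv_unique by blast
  show "G ** pinv G = pinv G ** G"
    using pinv unfolding is_pinv_def by (metis G sym matrix_transpose_mul)
qed

section \<open>Approximation of the pseudoinverse by regularisation\<close>

text \<open>Pair the equation with \<open>y\<close>, drop the nonnegative term
  \<open>(G *v y) \<bullet> (G *v y)\<close> and apply Cauchy-Schwarz. With \<open>w = 0\<close>
  this makes the regularised matrix invertible; with a small \<open>w\<close> it is the error
  estimate.\<close>

lemma norm_le_of_regularised_eq:
  fixes G :: "real ^ 'n ^ 'n"
  assumes G: "transpose G = G" and "e > 0" and y: "G *v (G *v y) + e *\<^sub>R y = w"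
  shows "e * norm y \<le> norm w"
proof (cases "y = 0")
  case False
  have "y \<bullet> w = (G *v y) \<bullet> (G *v y) + e * (y \<bullet> y)"
    using inner_matrix_vector_mult[of y G "G *v y"] by (simp only: y[symmetric] G inner_add_right inner_scaleR_right)
  then have "e * (norm y)\<^sup>2 \<le> y \<bullet> w"
    by (simp add: power2_norm_eq_inner)
  also have "\<dots> \<le> norm y * norm w" by (rule norm_cauchy_schwarz)
  finally have "norm y * (e * norm y) \<le> norm y * norm w"
    by (simp add: power2_eq_square mult_ac)
  then show ?thesis using False by simp
qed simp

text \<open>The Tikhonov-regularised least-squares problem, solved by Cramer's rule, so that
  the pseudoinverse is visibly a limit of functions built from determinants.\<close>

definition tikhonov :: "real \<Rightarrow> real ^ 'n ^ 'n \<Rightarrow> real ^ 'n \<Rightarrow> real ^ 'n" where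
  "tikhonov e G b = (\<chi> k. det (\<chi> i j. if j = k then (G *v b) $ i else (G ** G + e *\<^sub>R mat 1) $ i $ j)
     / det (G ** G + e *\<^sub>R mat 1))"

lemma tikhonov_eq:
  fixes G :: "real ^ 'n ^ 'n"
  assumes G: "transpose G = G" and e: "e > 0"
  shows "G *v (G *v tikhonov e G b) + e *\<^sub>R tikhonov e G b = G *v b"
proof -
  have app: "(G ** G + e *\<^sub>R mat 1) *v y = G *v (G *v y) + e *\<^sub>R y" for y
    by (simp add: matrix_vector_mult_add_rdistrib matrix_vector_mul_assoc flip: scaleR_matrix_vector_assoc)
  have "y = 0" if "(G ** G + e *\<^sub>R mat 1) *v y = 0" for y
    using norm_le_of_regularised_eq[OF G e that[unfolded app]] e
    by (simp add: mult_le_0_iff)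
  then have "invertible (G ** G + e *\<^sub>R mat 1)"
    by (simp add: invertible_left_inverse matrix_left_invertible_ker)
  then have "det (G ** G + e *\<^sub>R mat 1) \<noteq> 0"
    by (simp add: invertible_det_nz)
  from cramer[OF this, of "tikhonov e G b" "G *v b"] show ?thesis
    by (simp add: app) (simp add: tikhonov_def)
qed

lemma norm_pinv_minus_tikhonov_le:
  fixes G :: "real ^ 'n ^ 'n"
  assumes G: "transpose G = G" and e: "e > 0"
  shows "norm (pinv G *v b - tikhonov e G b) \<le> 2 * e * norm (pinv G *v (pinv G *v (pinv G *v b)))"
proof -
  define B where "B = pinv G"
  define y where "y = tikhonov e G b"
  define z where "z = B *v (B *v (B *v b))"
  have B: "G ** B ** G = G" "B ** G ** B = B" "G ** B = B ** G"
    using pinv_symmetric[OF G] by (auto simp: B_def is_pinv_def)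
  have "G ** G ** B = G" "G ** G ** B ** B ** B = B"
    using B by (metis matrix_mul_assoc)+
  then have 1: "G *v (G *v (B *v b)) = G *v b" "G *v (G *v z) = B *v b"
    by (simp_all add: z_def matrix_vector_mul_assoc matrix_mul_assoc)
  \<comment> \<open>Since \<open>B\<close> commutes with \<open>G\<close>, the corrected vector
    \<open>B *v b - e *\<^sub>R z\<close> solves the regularised equation up to the residual
    \<open>- (e\<^sup>2 *\<^sub>R z)\<close>. Hence \<open>d\<close> has norm at most
    \<open>e * norm z\<close>; the correction costs as much again, which is the factor 2.\<close>
  define d where "d = B *v b - y - e *\<^sub>R z"
  have "G *v (G *v d) + e *\<^sub>R d = - (e\<^sup>2 *\<^sub>R z)"
    using tikhonov_eq[OF G e, of b] 1
    by (simp add: d_def y_def[symmetric] matrix_vector_mult_diff_distrib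
          matrix_vector_mult_scaleR algebra_simps power2_eq_square)
  from norm_le_of_regularised_eq[OF G e this] have "norm d \<le> e * norm z"
    using e by (simp add: power2_eq_square)
  moreover have "norm (B *v b - y) \<le> norm d + norm (e *\<^sub>R z)"
    using norm_triangle_ineq[of d "e *\<^sub>R z"] by (simp add: d_def)
  ultimately show ?thesis using e by (simp add: B_def y_def z_def)
qed

lemma tikhonov_tendsto_pinv:
  fixes G :: "real ^ 'n ^ 'n"
  assumes G: "transpose G = G"
  shows "(\<lambda>n. tikhonov (1 / real (Suc n)) G b) \<longlonglongrightarrow> pinv G *v b"
proof -
  define C where "C = norm (pinv G *v (pinv G *v (pinv G *v b)))"
  have "(\<lambda>n. 2 * (1 / real (Suc n)) * C) \<longlonglongrightarrow> 0"
    using tendsto_mult_left[OF LIMSEQ_inverse_real_of_nat, of "2 * C"]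
    by (simp add: field_simps)
  then have "(\<lambda>n. tikhonov (1 / real (Suc n)) G b - pinv G *v b) \<longlonglongrightarrow> 0"
    by (rule Lim_null_comparison[rotated])
       (use norm_pinv_minus_tikhonov_le[OF G, of "1 / real (Suc n)" b for n] in
          \<open>auto simp: C_def norm_minus_commute intro!: always_eventually\<close>)
  then show ?thesis by (rule LIM_zero_cancel)
qed

section \<open>Continuity and measurability of matrix operations\<close>

lemma continuous_on_matrix_mult [continuous_intros]:
  fixes f :: "'a::topological_space \<Rightarrow> real ^ 'n ^ 'm" and g :: "'a \<Rightarrow> real ^ 'k ^ 'n"
  assumes "continuous_on s f" "continuous_on s g"
  shows "continuous_on s (\<lambda>x. f x ** g x)"
  unfolding matrix_matrix_mult_def by (intro continuous_intros assms)

lemma continuous_on_matrix_vector_product [continuous_intros]: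
  fixes f :: "'a::topological_space \<Rightarrow> real ^ 'n ^ 'm" and g :: "'a \<Rightarrow> real ^ 'n"
  assumes "continuous_on s f" "continuous_on s g"
  shows "continuous_on s (\<lambda>x. f x *v g x)"
  unfolding matrix_vector_mult_def by (intro continuous_intros assms)

lemma continuous_on_transpose [continuous_intros]:
  fixes f :: "'a::topological_space \<Rightarrow> real ^ 'n ^ 'm"
  assumes "continuous_on s f"
  shows "continuous_on s (\<lambda>x. transpose (f x))"
  unfolding transpose_def by (intro continuous_intros assms)

lemma continuous_on_det [continuous_intros]:
  fixes f :: "'a::topological_space \<Rightarrow> real ^ 'n ^ 'n"
  assumes "continuous_on s f"
  shows "continuous_on s (\<lambda>x. det (f x))"
  unfolding det_def by (intro continuous_intros assms)

lemma borel_measurable_vec_lambda: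
  fixes f :: "'n::finite \<Rightarrow> 'a \<Rightarrow> real"
  assumes "\<And>i. f i \<in> borel_measurable M"
  shows "(\<lambda>x. \<chi> i. f i x) \<in> borel_measurable M"
  by (subst borel_measurable_euclidean_space) (auto simp: Basis_vec_def inner_axis assms)

lemma borel_measurable_tikhonov:
  fixes G :: "'a::topological_space \<Rightarrow> real ^ 'n ^ 'n"
  assumes G: "continuous_on UNIV G" and b: "continuous_on UNIV b"
  shows "(\<lambda>x. tikhonov e (G x) (b x)) \<in> borel_measurable borel"
proof -
  have "continuous_on UNIV (\<lambda>x. if j = k then (G x *v b x) $ i else (G x ** G x + e *\<^sub>R mat 1) $ i $ j)"
    for i j k
    by (cases "j = k") (auto intro!: continuous_intros G b)
  then show ?thesis
    unfolding tikhonov_def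
    by (intro borel_measurable_vec_lambda borel_measurable_divide borel_measurable_continuous_onI
          continuous_intros G b)
qed

lemma borel_measurable_pinv:
  fixes G :: "'a::topological_space \<Rightarrow> real ^ 'n ^ 'n"
  assumes "continuous_on UNIV G" "continuous_on UNIV b" and G: "\<And>x. transpose (G x) = G x"
  shows "(\<lambda>x. pinv (G x) *v b x) \<in> borel_measurable borel"
  using borel_measurable_LIMSEQ_metric[OF borel_measurable_tikhonov[OF assms(1,2)] tikhonov_tendsto_pinv[OF G]]
  by auto

section \<open>Spectral properties of the averaged sketch\<close>

text \<open>With \<open>u = transpose A *v w\<close>, the square of \<open>norm u\<close> is
  \<open>w \<bullet> (A *v u)\<close>; after Cauchy-Schwarz one factor \<open>norm u\<close>
  cancels.\<close>

lemma onorm_transpose_bound: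
  fixes A :: "real ^ 'n ^ 'm"
  shows "norm (transpose A *v w) \<le> onorm ((*v) A) * norm w"
proof (cases "transpose A *v w = 0")
  case True
  then show ?thesis
    using onorm_pos_le[OF matrix_vector_mul_bounded_linear, of A] by simp
next
  case False
  define u where "u = transpose A *v w"
  have "(norm u)\<^sup>2 = w \<bullet> (A *v u)"
    by (simp only: inner_matrix_vector_mult u_def power2_norm_eq_inner)
  also have "\<dots> \<le> norm w * norm (A *v u)" by (rule norm_cauchy_schwarz)
  also have "\<dots> \<le> norm w * (onorm ((*v) A) * norm u)"
    by (intro mult_left_mono onorm matrix_vector_mul_bounded_linear norm_ge_zero)
  finally have "norm u * norm u \<le> norm u * (onorm ((*v) A) * norm w)"
    by (simp add: power2_eq_square mult_ac)
  then show ?thesis using False by (simp add: u_def del: transpose_matrix_vector)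
qed

text \<open>Compactness of the unit sphere of \<open>V\<close> gives a minimiser \<open>v\<close>
  with value \<open>r\<close>. The form of \<open>f - r\<close> is nonnegative on \<open>V\<close>
  and vanishes at \<open>v\<close>, hence \<open>f - r\<close> kills \<open>v\<close>: the minimiser
  is an eigenvector.\<close>

lemma rayleigh_minimiser:
  fixes f :: "'a::euclidean_space \<Rightarrow> 'a"
  assumes f: "linear f" and V: "subspace V" "V \<noteq> {0}" "f ` V \<subseteq> V"
    and sym: "\<And>x y. x \<in> V \<Longrightarrow> y \<in> V \<Longrightarrow> x \<bullet> f y = f x \<bullet> y"
  obtains r v where "v \<in> V" "v \<noteq> 0" "f v = r *\<^sub>R v" "\<And>w. w \<in> V \<Longrightarrow> r * (norm w)\<^sup>2 \<le> w \<bullet> f w"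
proof -
  interpret f: linear f by fact
  define K where "K = V \<inter> sphere 0 1"
  obtain u where u: "u \<in> V" "u \<noteq> 0" using V(1,2) subspace_0 by blast
  then have "u /\<^sub>R norm u \<in> K" by (simp add: K_def subspace_scale V(1))
  moreover have "compact K"
    unfolding K_def by (intro closed_Int_compact closed_subspace V compact_sphere)
  moreover have "continuous_on K (\<lambda>x. x \<bullet> f x)"
    using f by (intro continuous_intros linear_continuous_on) (simp add: linear_conv_bounded_linear)
  ultimately obtain v where v: "v \<in> K" "\<And>w. w \<in> K \<Longrightarrow> v \<bullet> f v \<le> w \<bullet> f w"
    using continuous_attains_inf[of K "\<lambda>x. x \<bullet> f x"] by blast
  define r where "r = v \<bullet> f v"
  have vV: "v \<in> V" "norm v = 1" "v \<noteq> 0" using v(1) by (auto simp: K_def)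
  have min: "r * (norm w)\<^sup>2 \<le> w \<bullet> f w" if "w \<in> V" for w
  proof (cases "w = 0")
    case False
    then have "w /\<^sub>R norm w \<in> K" using that by (simp add: K_def subspace_scale V(1))
    from v(2)[OF this] have "r \<le> w \<bullet> f w / (norm w)\<^sup>2"
      by (simp add: r_def f.scale power2_eq_square divide_simps)
    then show ?thesis using False by (simp add: divide_simps)
  qed (simp add: f.zero)
  define q where "q x = f x - r *\<^sub>R x" for x
  have "linear q"
    unfolding q_def by (intro linear_compose_sub f linear_compose_scale_right linear_ident)
  moreover have "q ` V \<subseteq> V"
    using V by (auto simp: q_def intro!: subspace_diff subspace_scale)
  moreover have "x \<bullet> q y = q x \<bullet> y" if "x \<in> V" "y \<in> V" for x y
    using sym[OF that] by (simp add: q_def inner_simps)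
  moreover have "0 \<le> x \<bullet> q x" if "x \<in> V" for x
    using min[OF that] by (simp add: q_def inner_simps power2_norm_eq_inner)
  moreover have "v \<bullet> q v = 0"
    using vV by (simp add: q_def inner_simps r_def dot_square_norm)
  ultimately have "q v = 0" using psd_form_eq_0_imp[OF _ V(1), of q v] vV by blast
  then show ?thesis
    using that[of v r] vV min by (auto simp: q_def)
qed

lemma subspace_col_space: "subspace (col_space A)"
  unfolding col_space_def
  by (intro linear_subspace_image matrix_vector_mul_linear subspace_UNIV)

text \<open>\<open>transpose A\<close> kills the orthogonal complement of
  \<open>col_space A\<close>, so any preimage may be replaced by its projection onto that space,
  which is where the Rayleigh bound applies.\<close>

lemma col_space_transpose_lift:
  fixes A :: "real ^ 'n ^ 'm"
  assumes "u \<in> col_space (transpose A)"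
  obtains w where "w \<in> col_space A" "u = transpose A *v w"
proof -
  obtain w where w: "u = transpose A *v w" using assms by (auto simp: col_space_def)
  obtain P :: "real ^ 'm ^ 'm" where P: "transpose P = P" "\<And>x. P *v x \<in> col_space A"
      "\<And>x. x \<in> col_space A \<Longrightarrow> P *v x = x"
    using exists_orthogonal_projection_matrix[OF subspace_col_space] by blast
  have "transpose A *v (P *v w) = transpose A *v w"
  proof (rule vector_eq_rdot[THEN iffD1], rule allI)
    fix z
    have "(P *v w) \<bullet> (A *v z) = w \<bullet> (P *v (A *v z))"
      unfolding inner_matrix_vector_mult[of w P] P(1) ..
    also have "P *v (A *v z) = A *v z"
      by (rule P(3)) (simp add: col_space_def)
    finally show "(transpose A *v (P *v w)) \<bullet> z = (transpose A *v w) \<bullet> z"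
      unfolding inner_matrix_vector_mult .
  qed
  with P(2)[of w] w show ?thesis by (intro that[of "P *v w"]) simp_all
qed

section \<open>Quadratic form of a single sketch\<close>

lemma sketched_gram_symmetric:
  "transpose (transpose S ** transpose A ** A ** S) = transpose S ** transpose A ** A ** S"
  for A :: "real ^ 'm ^ 'p" and S :: "real ^ 't ^ 'm"
  by (simp add: matrix_transpose_mul matrix_mul_assoc)

lemma sketch_H_symmetric: "transpose (sketch_H F S x) = sketch_H F S x"
  by (simp add: sketch_H_def matrix_transpose_mul matrix_mul_assoc sketched_gram_symmetric pinv_symmetric(2))

text \<open>This is the Penrose equation \<open>pinv G ** G ** pinv G = pinv G\<close> for the
  sketched Gram matrix, multiplied by \<open>S\<close> on the left and \<open>transpose S\<close> on
  the right.\<close>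

lemma sketch_H_gram: "sketch_H F S x ** transpose (DF F x) ** DF F x ** sketch_H F S x = sketch_H F S x"
proof -
  define G where "G = transpose S ** transpose (DF F x) ** DF F x ** S"
  have "pinv G ** G ** pinv G = pinv G"
    using pinv_symmetric(1)[OF sketched_gram_symmetric[of S "DF F x"]]
    unfolding is_pinv_def G_def by blast
  then have "S ** (pinv G ** G ** pinv G) ** transpose S = S ** pinv G ** transpose S" by simp
  then show ?thesis
    unfolding sketch_H_def G_def[symmetric] by (simp add: G_def matrix_mul_assoc)
qed

text \<open>Inserting the Gram identity splits the form into a square. For \<open>u = F x\<close>
  the right-hand side is the squared length of the SNR step before scaling by the stepsize.\<close>

lemma sketch_H_form: "u \<bullet> (sketch_H F S x *v u) = (norm (DF F x *v (sketch_H F S x *v u)))\<^sup>2"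
proof -
  let ?A = "DF F x" and ?H = "sketch_H F S x"
  have "u \<bullet> (?H *v u) = u \<bullet> (?H *v (transpose ?A *v (?A *v (?H *v u))))"
    by (simp add: matrix_vector_mul_assoc sketch_H_gram matrix_mul_assoc del: transpose_matrix_vector)
  also have "\<dots> = (?A *v (?H *v u)) \<bullet> (?A *v (?H *v u))"
    by (simp only: inner_matrix_vector_mult sketch_H_symmetric transpose_transpose)
  finally show ?thesis by (simp add: power2_norm_eq_inner)
qed

lemma sketch_H_form_nonneg: "0 \<le> u \<bullet> (sketch_H F S x *v u)"
  by (simp add: sketch_H_form)

text \<open>\<open>DF H DF^T\<close> is an orthogonal projection and \<open>g\<close> is the image
  of \<open>v\<close> under it; \<open>(norm g)\<^sup>2 = v \<bullet> g\<close> with Cauchy-Schwarz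
  gives \<open>norm g \<le> norm v\<close>.\<close>

lemma sketch_H_form_le:
  "(transpose (DF F x) *v v) \<bullet> (sketch_H F S x *v (transpose (DF F x) *v v)) \<le> (norm v)\<^sup>2"
proof -
  define u where "u = transpose (DF F x) *v v"
  define g where "g = DF F x *v (sketch_H F S x *v u)"
  have "(norm g)\<^sup>2 = u \<bullet> (sketch_H F S x *v u)" by (simp add: sketch_H_form g_def)
  also have "\<dots> = v \<bullet> g" by (simp only: g_def inner_matrix_vector_mult[of v] u_def)
  finally have *: "(norm g)\<^sup>2 = v \<bullet> g" .
  also have "\<dots> \<le> norm v * norm g" by (rule norm_cauchy_schwarz)
  finally have "norm g \<le> norm v" by (cases "g = 0") (auto simp: power2_eq_square)
  then have "(norm g)\<^sup>2 \<le> (norm v)\<^sup>2" by (simp add: power_mono)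
  then show ?thesis by (simp only: sketch_H_form g_def u_def)
qed

section \<open>Passing to the expected sketch\<close>

definition sketch_integrable :: "(real ^ 'p \<Rightarrow> real ^ 'm)
    \<Rightarrow> (real ^ 'p \<Rightarrow> (real ^ 't ^ 'm) measure) \<Rightarrow> real ^ 'p \<Rightarrow> bool" where
  "sketch_integrable F D x \<longleftrightarrow> integrable (D x) (\<lambda>S. sketch_H F S x)"

text \<open>For fixed \<open>u\<close> and \<open>w\<close> the map
  \<open>H \<mapsto> u \<bullet> (H *v w)\<close> is bounded linear and so commutes with the Bochner
  integral. Through it, symmetry and the bounds for single sketches pass to the mean.\<close>

lemma
  assumes int: "sketch_integrable F D x"
  shows integrable_sketch_H_form: "integrable (D x) (\<lambda>S. u \<bullet> (sketch_H F S x *v w))"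
    and expected_H_form: "u \<bullet> (expected_H F D x *v w) = (\<integral>S. u \<bullet> (sketch_H F S x *v w) \<partial>D x)"
proof -
  have "linear (\<lambda>H. u \<bullet> (H *v w))"
    by (rule linearI) (simp_all add: matrix_vector_mult_add_rdistrib inner_add_right flip: scaleR_matrix_vector_assoc)
  then have bl: "bounded_linear (\<lambda>H. u \<bullet> (H *v w))" by (simp add: linear_conv_bounded_linear)
  show "integrable (D x) (\<lambda>S. u \<bullet> (sketch_H F S x *v w))"
    by (rule integrable_bounded_linear[OF bl int[unfolded sketch_integrable_def]])
  show "u \<bullet> (expected_H F D x *v w) = (\<integral>S. u \<bullet> (sketch_H F S x *v w) \<partial>D x)"
    unfolding expected_H_def by (rule integral_bounded_linear[OF bl int[unfolded sketch_integrable_def], symmetric])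
qed

lemma expected_H_symmetric:
  fixes D :: "real ^ 'p \<Rightarrow> (real ^ 't ^ 'm) measure"
  assumes "sketch_integrable F D x"
  shows "u \<bullet> (expected_H F D x *v w) = (expected_H F D x *v u) \<bullet> w"
proof -
  have "(\<lambda>S :: real ^ 't ^ 'm. u \<bullet> (sketch_H F S x *v w)) = (\<lambda>S. w \<bullet> (sketch_H F S x *v u))"
    by (simp only: inner_matrix_vector_mult[of u] sketch_H_symmetric inner_commute)
  then show ?thesis by (simp only: inner_commute[of _ w] expected_H_form[OF assms])
qed

lemma expected_H_form_nonneg:
  assumes "sketch_integrable F D x"
  shows "0 \<le> u \<bullet> (expected_H F D x *v u)"
  by (simp add: expected_H_form[OF assms] sketch_H_form_nonneg)

lemma expected_H_form_le:
  assumes "prob_space (D x)" and int: "sketch_integrable F D x"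
  shows "(transpose (DF F x) *v v) \<bullet> (expected_H F D x *v (transpose (DF F x) *v v)) \<le> (norm v)\<^sup>2"
proof -
  interpret prob_space "D x" by fact
  have "(\<integral>S. (transpose (DF F x) *v v) \<bullet> (sketch_H F S x *v (transpose (DF F x) *v v)) \<partial>D x)
      \<le> (\<integral>S. (norm v)\<^sup>2 \<partial>D x)"
    by (intro integral_mono integrable_sketch_H_form[OF int] sketch_H_form_le integrable_const)
  also have "\<dots> = (norm v)\<^sup>2" by (simp add: prob_space)
  finally show ?thesis by (simp only: expected_H_form[OF int])
qed

section \<open>The averaged projection and its least Rayleigh quotient\<close>

definition avg_proj :: "(real ^ 'p \<Rightarrow> real ^ 'm) \<Rightarrow> (real ^ 'p \<Rightarrow> (real ^ 't ^ 'm) measure)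
    \<Rightarrow> real ^ 'p \<Rightarrow> real ^ 'p ^ 'p" where
  "avg_proj F D x = DF F x ** expected_H F D x ** transpose (DF F x)"

lemma avg_proj_form:
  "u \<bullet> (avg_proj F D x *v v) = (transpose (DF F x) *v u) \<bullet> (expected_H F D x *v (transpose (DF F x) *v v))"
  unfolding avg_proj_def matrix_vector_mul_assoc[symmetric]
  by (simp only: inner_matrix_vector_mult[of u])

text \<open>\<open>avg_proj F D x\<close> is symmetric and maps into the image of
  \<open>DF F x\<close>, so its Rayleigh quotient attains a minimum there, at an eigenvector. This
  identifies the \<open>LEAST\<close> in \<open>rho_at\<close> with a genuine minimum.\<close>

lemma rho_at_eigenvector:
  assumes int: "sketch_integrable F D x" and nz: "col_space (DF F x) \<noteq> {0}"
  obtains v where "v \<in> col_space (DF F x)" "v \<noteq> 0" "avg_proj F D x *v v = rho_at F D x *\<^sub>R v"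
    "\<And>w. w \<in> col_space (DF F x) \<Longrightarrow> rho_at F D x * (norm w)\<^sup>2 \<le> w \<bullet> (avg_proj F D x *v w)"
proof -
  let ?V = "col_space (DF F x)" and ?W = "avg_proj F D x"
  have "(*v) ?W ` ?V \<subseteq> ?V"
    by (auto simp: avg_proj_def col_space_def simp flip: matrix_vector_mul_assoc)
  moreover have "u \<bullet> (?W *v v) = (?W *v u) \<bullet> v" for u v
    by (simp only: inner_commute[of _ v] avg_proj_form expected_H_symmetric[OF int, of _ "transpose (DF F x) *v v"]) (simp only: inner_commute)
  ultimately obtain r v where v: "v \<in> ?V" "v \<noteq> 0" "?W *v v = r *\<^sub>R v"
    and min: "\<And>w. w \<in> ?V \<Longrightarrow> r * (norm w)\<^sup>2 \<le> w \<bullet> (?W *v w)"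
    using rayleigh_minimiser[OF matrix_vector_mul_linear subspace_col_space nz, of ?W] by metis
  have "rho_at F D x = r"
    unfolding rho_at_def avg_proj_def[symmetric]
  proof (rule Least_equality)
    show "\<exists>v\<in>?V - {0}. r = v \<bullet> (?W *v v) / (norm v)\<^sup>2"
      using v by (intro bexI[of _ v]) (auto simp: power2_norm_eq_inner)
    fix s assume "\<exists>v\<in>?V - {0}. s = v \<bullet> (?W *v v) / (norm v)\<^sup>2"
    then obtain u where u: "u \<in> ?V" "u \<noteq> 0" "s = u \<bullet> (?W *v u) / (norm u)\<^sup>2" by blast
    then show "r \<le> s" using min[OF u(1)] by (simp add: pos_le_divide_eq)
  qed
  with v min that show ?thesis by blast
qed

lemma rho_at_nonneg:
  assumes int: "sketch_integrable F D x" and nz: "col_space (DF F x) \<noteq> {0}"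
  shows "0 \<le> rho_at F D x"
proof -
  obtain v where v: "v \<noteq> 0" "avg_proj F D x *v v = rho_at F D x *\<^sub>R v"
    using rho_at_eigenvector[OF int nz] by metis
  have "0 \<le> v \<bullet> (avg_proj F D x *v v)"
    unfolding avg_proj_form by (rule expected_H_form_nonneg[OF int])
  then have "0 \<le> rho_at F D x * (v \<bullet> v)" using v by simp
  moreover have "0 < v \<bullet> v" using v by simp
  ultimately show ?thesis by (simp add: zero_le_mult_iff)
qed

lemma rho_at_le_1:
  assumes "prob_space (D x)" and int: "sketch_integrable F D x"
    and nz: "col_space (DF F x) \<noteq> {0}"
  shows "rho_at F D x \<le> 1"
proof -
  obtain v where v: "v \<noteq> 0" "avg_proj F D x *v v = rho_at F D x *\<^sub>R v"
    using rho_at_eigenvector[OF int nz] by metis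
  have "v \<bullet> (avg_proj F D x *v v) \<le> (norm v)\<^sup>2"
    unfolding avg_proj_form by (rule expected_H_form_le[OF assms(1) int])
  then show ?thesis using v by (simp add: power2_norm_eq_inner)
qed

text \<open>If the value were 0, its eigenvector \<open>v\<close> would give
  \<open>u = DF^T v\<close> with vanishing form, hence \<open>E u = 0\<close>. But \<open>u\<close>
  lies in the image of the symmetric \<open>E\<close>, so it is orthogonal to itself and zero; as
  \<open>v\<close> lies in the image of \<open>DF\<close>, it would vanish too.\<close>

lemma rho_at_pos:
  assumes int: "sketch_integrable F D x" and nz: "col_space (DF F x) \<noteq> {0}"
    and sub: "col_space (transpose (DF F x)) \<subseteq> col_space (expected_H F D x)"
  shows "0 < rho_at F D x"
proof (rule ccontr)
  assume "\<not> 0 < rho_at F D x"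
  then have 0: "rho_at F D x = 0" using rho_at_nonneg[OF int nz] by simp
  obtain v where v: "v \<in> col_space (DF F x)" "v \<noteq> 0" "avg_proj F D x *v v = rho_at F D x *\<^sub>R v"
    using rho_at_eigenvector[OF int nz] by metis
  define u where "u = transpose (DF F x) *v v"
  have "u \<bullet> (expected_H F D x *v u) = 0"
    using v(3) 0 avg_proj_form[of v F D x v] by (simp add: u_def)
  then have Eu: "expected_H F D x *v u = 0"
    by (intro psd_form_eq_0_imp[of "(*v) (expected_H F D x)" UNIV])
       (auto intro: expected_H_symmetric[OF int] expected_H_form_nonneg[OF int])
  have "u \<in> col_space (expected_H F D x)"
    using sub by (auto simp: u_def col_space_def)
  then obtain z where "u = expected_H F D x *v z" by (auto simp: col_space_def)
  then have "u \<bullet> u = z \<bullet> (expected_H F D x *v u)"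
    using expected_H_symmetric[OF int, of z u] by simp
  with Eu have "u = 0" by simp
  obtain y where "v = DF F x *v y" using v(1) by (auto simp: col_space_def)
  then have "v \<bullet> v = u \<bullet> y" by (metis u_def inner_matrix_vector_mult)
  with \<open>u = 0\<close> v(2) show False by simp
qed

text \<open>An eigenvector with eigenvalue \<open>l \<noteq> 0\<close> is \<open>1 / l\<close> times
  its own image, hence lies in the image of \<open>DF F x\<close>, where the Rayleigh bound forces
  \<open>l\<close> to be at least \<open>rho_at F D x\<close>.\<close>

lemma rho_at_eq_lambda_min_pos:
  assumes int: "sketch_integrable F D x" and nz: "col_space (DF F x) \<noteq> {0}"
    and sub: "col_space (transpose (DF F x)) \<subseteq> col_space (expected_H F D x)"
  shows "lambda_min_pos (avg_proj F D x) = rho_at F D x"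
  unfolding lambda_min_pos_def
proof (rule Least_equality)
  obtain v where v: "v \<in> col_space (DF F x)" "v \<noteq> 0" "avg_proj F D x *v v = rho_at F D x *\<^sub>R v"
    "\<And>w. w \<in> col_space (DF F x) \<Longrightarrow> rho_at F D x * (norm w)\<^sup>2 \<le> w \<bullet> (avg_proj F D x *v w)"
    using rho_at_eigenvector[OF int nz] by metis
  show "eigval (avg_proj F D x) (rho_at F D x) \<and> rho_at F D x \<noteq> 0"
    using v rho_at_pos[OF assms] by (auto simp: eigval_def)
  fix l assume "eigval (avg_proj F D x) l \<and> l \<noteq> 0"
  then obtain w where w: "w \<noteq> 0" "avg_proj F D x *v w = l *\<^sub>R w" and l: "l \<noteq> 0"
    by (auto simp: eigval_def)
  have "l *\<^sub>R w \<in> col_space (DF F x)"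
    unfolding w(2)[symmetric] by (auto simp: avg_proj_def col_space_def simp flip: matrix_vector_mul_assoc)
  moreover have "w = (1 / l) *\<^sub>R (l *\<^sub>R w)" using l by simp
  ultimately have "w \<in> col_space (DF F x)"
    by (metis subspace_scale subspace_col_space)
  from v(4)[OF this] show "rho_at F D x \<le> l"
    using w by (simp add: power2_norm_eq_inner)
qed

lemma expected_sketched_residual_ge:
  assumes int: "sketch_integrable F D x" and nz: "col_space (DF F x) \<noteq> {0}"
    and F: "F x \<in> col_space (transpose (DF F x))" and L: "onorm ((*v) (DF F x)) \<le> L"
  shows "rho_at F D x * (norm (F x))\<^sup>2 \<le> L\<^sup>2 * (F x \<bullet> (expected_H F D x *v F x))"
proof -
  obtain w where w: "w \<in> col_space (DF F x)" "F x = transpose (DF F x) *v w"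
    using col_space_transpose_lift[OF F] .
  have "norm (F x) \<le> onorm ((*v) (DF F x)) * norm w"
    unfolding w(2) by (rule onorm_transpose_bound)
  also have "\<dots> \<le> L * norm w" by (intro mult_right_mono L) simp
  finally have "(norm (F x))\<^sup>2 \<le> (L * norm w)\<^sup>2" by (simp add: power_mono)
  then have "rho_at F D x * (norm (F x))\<^sup>2 \<le> L\<^sup>2 * (rho_at F D x * (norm w)\<^sup>2)"
    using mult_left_mono[OF _ rho_at_nonneg[OF int nz]] by (fastforce simp: power_mult_distrib mult_ac)
  also have "\<dots> \<le> L\<^sup>2 * (w \<bullet> (avg_proj F D x *v w))"
    using rho_at_eigenvector[OF int nz] w(1) by (metis mult_left_mono zero_le_power2)
  finally show ?thesis unfolding avg_proj_form w(2) .
qed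

section \<open>Gradient of the sketched objective and descent in one step\<close>

text \<open>The matrix \<open>sketch_H F S y\<close> is constant in \<open>x\<close>; by its
  symmetry the two terms of the product rule coincide and cancel the factor \<open>1 / 2\<close>.
  Uniqueness of derivatives resolves the \<open>THE\<close> in \<open>grad\<close>.\<close>

lemma grad_sketched_obj:
  assumes "continuously_differentiable F"
  shows "grad (sketched_obj F S y) x = DF F x *v (sketch_H F S y *v F x)"
proof -
  let ?H = "sketch_H F S y"
  have "(F has_derivative (\<lambda>h. transpose (DF F x) *v h)) (at x)"
    using assms by (simp add: continuously_differentiable_def DF_def jacobian_works del: transpose_matrix_vector)
  note this[derivative_intros]
  have H: "((\<lambda>x. ?H *v F x) has_derivative (\<lambda>h. ?H *v (transpose (DF F x) *v h))) (at x)"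
    by (rule bounded_linear.has_derivative[OF matrix_vector_mul_bounded_linear]) (rule derivative_intros)
  have sym: "F x \<bullet> (?H *v u) = u \<bullet> (?H *v F x)" for u
    by (simp only: inner_matrix_vector_mult[of "F x"] sketch_H_symmetric inner_commute)
  have *: "(sketched_obj F S y has_derivative
     (\<lambda>h. 1 / 2 * (F x \<bullet> (?H *v (transpose (DF F x) *v h)) + (transpose (DF F x) *v h) \<bullet> (?H *v F x)))) (at x)"
    unfolding sketched_obj_def[abs_def]
    by (intro has_derivative_mult_right has_derivative_inner H) (rule derivative_intros)
  have "1 / 2 * (F x \<bullet> (?H *v (transpose (DF F x) *v h)) + (transpose (DF F x) *v h) \<bullet> (?H *v F x))
      = h \<bullet> (DF F x *v (?H *v F x))" for h
    unfolding sym inner_matrix_vector_mult[of h] by simp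
  with * have g: "GDERIV (sketched_obj F S y) x :> DF F x *v (?H *v F x)"
    by (simp add: gderiv_def del: transpose_matrix_vector)
  show ?thesis
    unfolding grad_def
  proof (rule the_equality)
    fix d assume "GDERIV (sketched_obj F S y) x :> d"
    then have "(\<lambda>h. h \<bullet> d) = (\<lambda>h. h \<bullet> (DF F x *v (?H *v F x)))"
      using g unfolding gderiv_def by (rule has_derivative_unique)
    then show "d = DF F x *v (?H *v F x)"
      by (metis vector_eq_ldot)
  qed (rule g)
qed

lemma SNR_step_descent:
  assumes F: "continuously_differentiable F" "F xs = 0" and \<gamma>: "0 < \<gamma>"
    and convex: "sketched_obj F S x xs \<ge> sketched_obj F S x x + grad (sketched_obj F S x) x \<bullet> (xs - x)"
  shows "(norm (x - \<gamma> *\<^sub>R (DF F x *v (sketch_H F S x *v F x)) - xs))\<^sup>2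
    + \<gamma> * (1 - \<gamma>) * (F x \<bullet> (sketch_H F S x *v F x)) \<le> (norm (x - xs))\<^sup>2"
proof -
  define g where "g = DF F x *v (sketch_H F S x *v F x)"
  define q where "q = F x \<bullet> (sketch_H F S x *v F x)"
  have gg: "g \<bullet> g = q"
    by (simp add: q_def g_def sketch_H_form power2_norm_eq_inner)
  \<comment> \<open>The objective vanishes at \<open>xs\<close> because \<open>F xs = 0\<close>, and
    its value at \<open>x\<close> is \<open>q / 2\<close>.\<close>
  have "q / 2 \<le> g \<bullet> (x - xs)"
    using convex unfolding grad_sketched_obj[OF F(1)] g_def[symmetric]
    by (simp add: sketched_obj_def F(2) q_def[symmetric] inner_diff_right)
  then have "\<gamma> * q \<le> 2 * \<gamma> * (g \<bullet> (x - xs))" using \<gamma> by simp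
  moreover have "(norm (x - \<gamma> *\<^sub>R g - xs))\<^sup>2 = (norm (x - xs))\<^sup>2 - 2 * \<gamma> * (g \<bullet> (x - xs)) + \<gamma>\<^sup>2 * (g \<bullet> g)"
    unfolding power2_norm_eq_inner
    by (simp add: inner_diff_left inner_diff_right inner_commute algebra_simps power2_eq_square)
  ultimately show ?thesis
    unfolding g_def[symmetric] q_def[symmetric] gg by (simp add: algebra_simps power2_eq_square)
qed

section \<open>Conditional laws given by a kernel\<close>

text \<open>Both sides integrate \<open>h\<close> against a law on the product: the joint law
  \<open>N1\<close> of \<open>(X, S)\<close>, and \<open>N2\<close>, which takes \<open>X\<close>
  from \<open>M\<close> and then draws the second component from \<open>K (X \<omega>)\<close>. The
  conditional probabilities show that the two agree on rectangles.\<close>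

lemma nn_integral_kernel_cond:
  fixes S :: "'w \<Rightarrow> 's" and X :: "'w \<Rightarrow> 'x"
  assumes "prob_space M" and sub: "subalgebra M N"
    and X: "X \<in> N \<rightarrow>\<^sub>M A" and S[measurable]: "S \<in> M \<rightarrow>\<^sub>M B"
    and K[measurable]: "K \<in> A \<rightarrow>\<^sub>M prob_algebra B"
    and cond: "\<And>b. b \<in> sets B \<Longrightarrow> AE \<omega> in M.
       real_cond_exp M N (indicator (S -` b \<inter> space M)) \<omega> = measure (K (X \<omega>)) b"
    and h[measurable]: "h \<in> borel_measurable (A \<Otimes>\<^sub>M B)"
  shows "(\<integral>\<^sup>+\<omega>. h (X \<omega>, S \<omega>) \<partial>M) = (\<integral>\<^sup>+\<omega>. (\<integral>\<^sup>+s. h (X \<omega>, s) \<partial>K (X \<omega>)) \<partial>M)"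
proof -
  interpret prob_space M by fact
  interpret finite_measure_subalgebra M N by unfold_locales (rule sub)
  have XM[measurable]: "X \<in> M \<rightarrow>\<^sub>M A"
    using measurable_from_subalg[OF sub X] .
  have KX[measurable]: "(\<lambda>\<omega>. K (X \<omega>)) \<in> M \<rightarrow>\<^sub>M prob_algebra B" by measurable
  have K_prob: "prob_space (K (X \<omega>))" "sets (K (X \<omega>)) = sets B" if "\<omega> \<in> space M" for \<omega>
    using measurable_space[OF KX that] by (auto simp: space_prob_algebra)
  define N1 where "N1 = distr M (A \<Otimes>\<^sub>M B) (\<lambda>\<omega>. (X \<omega>, S \<omega>))"
  define k where "k \<omega> = distr (K (X \<omega>)) (A \<Otimes>\<^sub>M B) (Pair (X \<omega>))" for \<omega>
  \<comment> \<open>Measurability of \<open>k\<close> is obtained from this monadic form; the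
    \<open>distr\<close> form of \<open>k\<close> is the one that unfolds in integrals.\<close>
  have "(\<lambda>\<omega>. K (X \<omega>) \<bind> (\<lambda>s. return (A \<Otimes>\<^sub>M B) (X \<omega>, s))) \<in> M \<rightarrow>\<^sub>M prob_algebra (A \<Otimes>\<^sub>M B)"
    by measurable
  moreover have "K (X \<omega>) \<bind> (\<lambda>s. return (A \<Otimes>\<^sub>M B) (X \<omega>, s)) = k \<omega>" if "\<omega> \<in> space M" for \<omega>
    unfolding k_def
  proof (rule bind_return_distr')
    show "space (K (X \<omega>)) \<noteq> {}" using K_prob[OF that] prob_space.not_empty by blast
    have "Pair (X \<omega>) \<in> B \<rightarrow>\<^sub>M A \<Otimes>\<^sub>M B" using measurable_space[OF XM that] by simp
    then show "Pair (X \<omega>) \<in> K (X \<omega>) \<rightarrow>\<^sub>M A \<Otimes>\<^sub>M B"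
      using measurable_cong_sets[OF K_prob(2)[OF that] refl] by blast
  qed
  ultimately have k: "k \<in> M \<rightarrow>\<^sub>M prob_algebra (A \<Otimes>\<^sub>M B)"
    by (simp cong: measurable_cong)
  then have k'[measurable]: "k \<in> M \<rightarrow>\<^sub>M subprob_algebra (A \<Otimes>\<^sub>M B)"
    by (rule measurable_prob_algebraD)
  have nn_k: "(\<integral>\<^sup>+z. g z \<partial>k \<omega>) = (\<integral>\<^sup>+s. g (X \<omega>, s) \<partial>K (X \<omega>))"
    if g: "g \<in> borel_measurable (A \<Otimes>\<^sub>M B)" and w: "\<omega> \<in> space M" for g \<omega>
  proof -
    have "Pair (X \<omega>) \<in> B \<rightarrow>\<^sub>M A \<Otimes>\<^sub>M B" using measurable_space[OF XM w] by simp
    then have "Pair (X \<omega>) \<in> K (X \<omega>) \<rightarrow>\<^sub>M A \<Otimes>\<^sub>M B"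
      using measurable_cong_sets[OF K_prob(2)[OF w] refl] by blast
    then show ?thesis unfolding k_def using g by (subst nn_integral_distr) auto
  qed
  define N2 where "N2 = M \<bind> k"
  have sets_N2: "sets N2 = sets (A \<Otimes>\<^sub>M B)"
    unfolding N2_def by (rule sets_bind[OF sets_kernel[OF k']]) (simp_all add: not_empty)
  have rect: "emeasure N1 (a \<times> b) = emeasure N2 (a \<times> b)" if a: "a \<in> sets A" and b: "b \<in> sets B" for a b
  proof -
    define U where "U = X -` a \<inter> space M"
    \<comment> \<open>Membership in \<open>N\<close>, not just in \<open>M\<close>, is what allows
      the indicator of the \<open>S\<close>-event to be replaced by its conditional expectation
      under the integral over \<open>U\<close>.\<close>
    have U: "U \<in> sets N"
      using measurable_sets[OF X a] sub by (simp add: U_def subalgebra_def)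
    have UM[measurable]: "U \<in> sets M" using U sub by (auto simp: subalgebra_def)
    have Vm: "S -` b \<inter> space M \<in> sets M" using b by measurable
    have ab: "a \<times> b \<in> sets (A \<Otimes>\<^sub>M B)" using a b by simp
    have kb[measurable]: "(\<lambda>\<omega>. measure (K (X \<omega>)) b) \<in> borel_measurable M"
      using b by measurable
    have "emeasure N1 (a \<times> b) = emeasure M (U \<inter> (S -` b \<inter> space M))"
      unfolding N1_def using ab by (subst emeasure_distr) (auto simp: U_def intro!: arg_cong[where f="emeasure M"])
    also have "\<dots> = ennreal (measure M (U \<inter> (S -` b \<inter> space M)))"
      by (rule emeasure_eq_measure)
    also have "measure M (U \<inter> (S -` b \<inter> space M)) = (\<integral>\<omega>\<in>U. indicator (S -` b \<inter> space M) \<omega> \<partial>M)"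
      using Vm UM by (simp add: set_lebesgue_integral_def indicator_inter_arith[symmetric])
    also have "\<dots> = (\<integral>\<omega>\<in>U. real_cond_exp M N (indicator (S -` b \<inter> space M)) \<omega> \<partial>M)"
      using Vm by (intro real_cond_exp_intA U integrable_real_indicator) (auto simp: emeasure_eq_measure)
    also have "\<dots> = (\<integral>\<omega>\<in>U. measure (K (X \<omega>)) b \<partial>M)"
      unfolding set_lebesgue_integral_def
      using cond[OF b] by (intro integral_cong_AE) auto
    also have "ennreal \<dots> = (\<integral>\<^sup>+\<omega>. ennreal (indicator U \<omega> * measure (K (X \<omega>)) b) \<partial>M)"
      unfolding set_lebesgue_integral_def real_scaleR_def
      using K_prob(1)
      by (intro nn_integral_eq_integral[symmetric] integrable_const_bound[where B=1] AE_I2)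
         (auto simp: indicator_def prob_space.prob_le_1)
    also have "\<dots> = (\<integral>\<^sup>+\<omega>. emeasure (k \<omega>) (a \<times> b) \<partial>M)"
    proof (rule nn_integral_cong)
      fix \<omega> assume w: "\<omega> \<in> space M"
      interpret K: prob_space "K (X \<omega>)" using K_prob(1)[OF w] .
      have "emeasure (k \<omega>) (a \<times> b) = (\<integral>\<^sup>+z. indicator (a \<times> b) z \<partial>k \<omega>)"
        using ab by (simp add: k_def)
      also have "\<dots> = (\<integral>\<^sup>+s. indicator (a \<times> b) (X \<omega>, s) \<partial>K (X \<omega>))"
        using ab w by (intro nn_k) auto
      also have "\<dots> = (\<integral>\<^sup>+s. indicator U \<omega> * indicator b s \<partial>K (X \<omega>))"
        using w by (intro nn_integral_cong) (auto simp: indicator_def U_def)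
      also have "\<dots> = indicator U \<omega> * emeasure (K (X \<omega>)) b"
        using b K_prob(2)[OF w] by (simp add: nn_integral_cmult)
      finally show "ennreal (indicator U \<omega> * measure (K (X \<omega>)) b) = emeasure (k \<omega>) (a \<times> b)"
        by (simp add: K.emeasure_eq_measure indicator_def)
    qed
    also have "\<dots> = emeasure N2 (a \<times> b)"
      unfolding N2_def using ab by (intro emeasure_bind[symmetric, OF _ k']) (auto simp: not_empty)
    finally show ?thesis .
  qed
  \<comment> \<open>Rectangles are stable under intersection, generate the product
    \<open>\<sigma>\<close>-algebra and include the whole space, which has finite mass.\<close>
  have "N1 = N2"
  proof (rule measure_eqI_generator_eq)
    let ?E = "{a \<times> b | a b. a \<in> sets A \<and> b \<in> sets B}"
    show "Int_stable ?E" by (rule Int_stable_pair_measure_generator)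
    show "?E \<subseteq> Pow (space A \<times> space B)" by (rule pair_measure_closed)
    show "emeasure N1 z = emeasure N2 z" if "z \<in> ?E" for z using that rect by auto
    show "sets N1 = sigma_sets (space A \<times> space B) ?E" by (simp add: N1_def sets_pair_measure)
    show "sets N2 = sigma_sets (space A \<times> space B) ?E" by (simp add: sets_N2 sets_pair_measure)
    show "range (\<lambda>_::nat. space A \<times> space B) \<subseteq> ?E" by auto
    show "(\<Union>i::nat. space A \<times> space B) = space A \<times> space B" by simp
    interpret N1: prob_space N1 unfolding N1_def by (intro prob_space_distr) measurable
    show "emeasure N1 (space A \<times> space B) \<noteq> \<infinity>" by simp
  qed
  have "(\<integral>\<^sup>+\<omega>. h (X \<omega>, S \<omega>) \<partial>M) = (\<integral>\<^sup>+z. h z \<partial>N1)"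
    unfolding N1_def by (subst nn_integral_distr) auto
  also have "\<dots> = (\<integral>\<^sup>+\<omega>. (\<integral>\<^sup>+z. h z \<partial>k \<omega>) \<partial>M)"
    unfolding \<open>N1 = N2\<close> N2_def by (rule nn_integral_bind[OF h k'])
  also have "\<dots> = (\<integral>\<^sup>+\<omega>. (\<integral>\<^sup>+s. h (X \<omega>, s) \<partial>K (X \<omega>)) \<partial>M)"
    by (intro nn_integral_cong nn_k h)
  finally show ?thesis .
qed

section \<open>Convergence of the iteration\<close>

lemma continuously_differentiable_imp_continuous_on:
  assumes "continuously_differentiable F"
  shows "continuous_on UNIV F" "continuous_on UNIV (DF F)"
proof -
  have "\<forall>x. isCont F x"
    using assms by (simp add: continuously_differentiable_def differentiable_imp_continuous_within)
  then show "continuous_on UNIV F" by (intro continuous_at_imp_continuous_on) simp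
qed (use assms in \<open>simp add: continuously_differentiable_def\<close>)

text \<open>Joint measurability in the point and the sketch: the pseudoinverse is applied to the
  continuous vector \<open>transpose S *v F x\<close>, and the remaining product with
  \<open>S\<close> is continuous.\<close>

lemma borel_measurable_sketch_H_residual:
  fixes F :: "real ^ 'p \<Rightarrow> real ^ 'm"
  assumes F: "continuously_differentiable F"
  shows "(\<lambda>z. sketch_H F (snd z :: real ^ 't ^ 'm) (fst z) *v F (fst z)) \<in> borel_measurable (borel \<Otimes>\<^sub>M borel)"
proof -
  let ?S = "\<lambda>z :: (real ^ 'p) \<times> (real ^ 't ^ 'm). snd z" and ?A = "\<lambda>z :: (real ^ 'p) \<times> (real ^ 't ^ 'm). DF F (fst z)"
  have cont: "continuous_on UNIV (\<lambda>z. f (fst z))"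
    if "continuous_on UNIV f" for f :: "real ^ 'p \<Rightarrow> 'b::topological_space"
    by (rule continuous_on_compose2[OF that continuous_on_fst[OF continuous_on_id] subset_UNIV])
  have F_cont: "continuous_on UNIV (\<lambda>z :: (real ^ 'p) \<times> (real ^ 't ^ 'm). F (fst z))"
    by (rule cont[OF continuously_differentiable_imp_continuous_on(1)[OF F]])
  have A_cont: "continuous_on UNIV ?A"
    by (rule cont[OF continuously_differentiable_imp_continuous_on(2)[OF F]])
  have S_cont: "continuous_on UNIV ?S" by (rule continuous_on_snd[OF continuous_on_id])
  define G where "G z = transpose (?S z) ** transpose (?A z) ** ?A z ** ?S z" for z
  define c where "c z = transpose (?S z) *v F (fst z)" for z
  have "continuous_on UNIV G"
    unfolding G_def by (intro continuous_on_matrix_mult continuous_on_transpose A_cont S_cont)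
  moreover have "continuous_on UNIV c"
    unfolding c_def by (intro continuous_on_matrix_vector_product continuous_on_transpose F_cont S_cont)
  moreover have "transpose (G z) = G z" for z
    unfolding G_def by (rule sketched_gram_symmetric)
  ultimately have w: "(\<lambda>z. pinv (G z) *v c z) \<in> borel_measurable borel"
    by (rule borel_measurable_pinv)
  have "continuous_on UNIV (\<lambda>p. (fst p :: real ^ 't ^ 'm) *v snd p)"
    by (intro continuous_intros)
  from borel_measurable_continuous_Pair[OF borel_measurable_continuous_onI[OF S_cont] w this]
  have "(\<lambda>z. ?S z *v (pinv (G z) *v c z)) \<in> borel_measurable borel"
    by simp
  moreover have "?S z *v (pinv (G z) *v c z) = sketch_H F (snd z) (fst z) *v F (fst z)" for z
    unfolding sketch_H_def G_def c_def by (simp only: matrix_vector_mul_assoc matrix_mul_assoc)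
  ultimately show ?thesis
    unfolding borel_prod by simp
qed

lemma borel_measurable_sketched_residual_form:
  assumes F: "continuously_differentiable F"
  shows "(\<lambda>z. F (fst z) \<bullet> (sketch_H F (snd z) (fst z) *v F (fst z))) \<in> borel_measurable (borel \<Otimes>\<^sub>M borel)"
proof -
  note [measurable] = borel_measurable_sketch_H_residual[OF F]
    borel_measurable_continuous_onI[OF continuously_differentiable_imp_continuous_on(1)[OF F]]
  show ?thesis by measurable
qed

lemma SNR_iter_Suc:
  "SNR_iter F \<gamma> x0 S (Suc k) = (let x = SNR_iter F \<gamma> x0 S k in
     x - \<gamma> *\<^sub>R (DF F x *v (sketch_H F (S k) x *v F x)))"
  by (simp add: sketch_H_def Let_def matrix_vector_mul_assoc matrix_mul_assoc)

text \<open>The iterate \<open>k\<close> reads only the sketches before \<open>k\<close>. With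
  \<open>N\<close> the history this says that the iterates are predictable for the sketches; with
  \<open>N = M\<close> it is plain measurability.\<close>

lemma borel_measurable_SNR_iter:
  assumes F: "continuously_differentiable F"
    and "\<And>j. j < k \<Longrightarrow> S j \<in> borel_measurable N"
  shows "(\<lambda>\<omega>. SNR_iter F \<gamma> x0 (\<lambda>j. S j \<omega>) k) \<in> borel_measurable N"
  using assms(2)
proof (induction k)
  case (Suc k)
  define X where "X \<omega> = SNR_iter F \<gamma> x0 (\<lambda>j. S j \<omega>) k" for \<omega>
  have [measurable]: "X \<in> borel_measurable N" "S k \<in> borel_measurable N"
    using Suc by (auto simp: X_def[abs_def])
  have h: "(\<lambda>\<omega>. sketch_H F (S k \<omega>) (X \<omega>) *v F (X \<omega>)) \<in> borel_measurable N"
    using measurable_compose[OF measurable_Pair borel_measurable_sketch_H_residual[OF F], of X N "S k"] by simp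
  have "DF F \<in> borel_measurable borel"
    by (intro borel_measurable_continuous_onI continuously_differentiable_imp_continuous_on F)
  then have "(\<lambda>\<omega>. DF F (X \<omega>)) \<in> borel_measurable N"
    by measurable
  then have [measurable]: "(\<lambda>\<omega>. DF F (X \<omega>) *v (sketch_H F (S k \<omega>) (X \<omega>) *v F (X \<omega>))) \<in> borel_measurable N"
    by (rule borel_measurable_continuous_Pair[OF _ h]) (intro continuous_intros)
  show ?case
    unfolding SNR_iter_Suc Let_def X_def[symmetric] by measurable
qed simp

lemma measurable_history: "j < k \<Longrightarrow> S j \<in> borel_measurable (history M S k)"
proof -
  assume j: "j < k"
  have "(\<lambda>\<omega>. \<lambda>j\<in>{..<k}. S j \<omega>) \<in> history M S k \<rightarrow>\<^sub>M (\<Pi>\<^sub>M j\<in>{..<k}. borel)"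
    unfolding history_def by (rule measurable_vimage_algebra1) (auto simp: space_PiM)
  from measurable_compose[OF this measurable_component_singleton[of j]] j
  show ?thesis by simp
qed

lemma subalgebra_history:
  assumes "\<And>j. S j \<in> borel_measurable M"
  shows "subalgebra M (history M S k)"
proof -
  have S: "(\<lambda>\<omega>. \<lambda>j\<in>{..<k}. S j \<omega>) \<in> M \<rightarrow>\<^sub>M (\<Pi>\<^sub>M j\<in>{..<k}. borel)"
    by (intro measurable_restrict assms)
  then have "(\<lambda>\<omega>. \<lambda>j\<in>{..<k}. S j \<omega>) \<in> space M \<rightarrow> space (\<Pi>\<^sub>M j\<in>{..<k}. borel)"
    by (auto dest: measurable_space)
  with S show ?thesis
    unfolding subalgebra_def history_def by (auto simp: sets_vimage_algebra2 intro: measurable_sets)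
qed

lemma nn_integral_SNR_sketch:
  fixes h :: "(real ^ 'p) \<times> (real ^ 't ^ 'm) \<Rightarrow> ennreal"
  assumes F: "continuously_differentiable F" and S: "SNR_sketches F D \<gamma> x0 M S"
    and h: "h \<in> borel_measurable (borel \<Otimes>\<^sub>M borel)"
  defines "X \<equiv> \<lambda>k \<omega>. SNR_iter F \<gamma> x0 (\<lambda>j. S j \<omega>) k"
  shows "(\<integral>\<^sup>+\<omega>. h (X k \<omega>, S k \<omega>) \<partial>M) = (\<integral>\<^sup>+\<omega>. (\<integral>\<^sup>+s. h (X k \<omega>, s) \<partial>D (X k \<omega>)) \<partial>M)"
proof (rule nn_integral_kernel_cond)
  show "prob_space M" "D \<in> borel \<rightarrow>\<^sub>M prob_algebra borel" "S k \<in> borel_measurable M"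
    using S by (auto simp: SNR_sketches_def)
  show "subalgebra M (history M S k)"
    using S by (intro subalgebra_history) (auto simp: SNR_sketches_def)
  show "X k \<in> borel_measurable (history M S k)"
    unfolding X_def by (intro borel_measurable_SNR_iter F measurable_history)
  show "AE \<omega> in M. real_cond_exp M (history M S k) (indicator (S k -` b \<inter> space M)) \<omega> = measure (D (X k \<omega>)) b"
    if "b \<in> sets borel" for b
    using S that by (auto simp: SNR_sketches_def X_def)
qed (rule h)

lemma onorm_DF_le_SUP:
  assumes F: "continuously_differentiable F" and x: "norm (x - xs) \<le> r"
  shows "onorm ((*v) (DF F x)) \<le> (SUP x \<in> {x. norm (x - xs) \<le> r}. onorm ((*v) (DF F x)))"
proof (rule cSUP_upper)
  \<comment> \<open>The sum of absolute entries dominates the operator norm and is continuous, hence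
    bounded on the compact ball; so the supremum is over a bounded set.\<close>
  let ?g = "\<lambda>x. \<Sum>i\<in>UNIV. \<Sum>j\<in>UNIV. \<bar>DF F x $ i $ j\<bar>"
  have "{x. norm (x - xs) \<le> r} = cball xs r" by (auto simp: dist_norm norm_minus_commute)
  moreover have "continuous_on (cball xs r) ?g"
    by (intro continuous_intros continuous_on_subset[OF continuously_differentiable_imp_continuous_on(2)[OF F]]) simp
  then have "bounded (?g ` cball xs r)"
    by (intro compact_imp_bounded compact_continuous_image) simp_all
  then obtain B where "\<And>x. x \<in> cball xs r \<Longrightarrow> ?g x \<le> B"
    by (meson bdd_above.unfold bounded_imp_bdd_above image_eqI)
  moreover have "onorm ((*v) (DF F x)) \<le> ?g x" for x
    by (rule onorm_le_matrix_component_sum)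
  ultimately show "bdd_above ((\<lambda>x. onorm ((*v) (DF F x))) ` {x. norm (x - xs) \<le> r})"
    by (intro bdd_aboveI2[of _ _ B]) (metis (lifting) mem_Collect_eq order_trans)
qed (use x in simp)

section \<open>Summed descent and the rate in expectation\<close>

text \<open>The one-step inequalities telescope along a fixed sequence of sketches. The first
  summand confines the iterates to the ball, the second bounds the accumulated forms.\<close>

lemma SNR_descent:
  assumes F: "continuously_differentiable F" "F xs = 0" and \<gamma>: "0 < \<gamma>"
    and convex: "\<And>k. let x = SNR_iter F \<gamma> x0 S k; f = sketched_obj F (S k) x
        in f xs \<ge> f x + grad f x \<bullet> (xs - x)"
  defines "X \<equiv> SNR_iter F \<gamma> x0 S"
  shows "(norm (X k - xs))\<^sup>2 + \<gamma> * (1 - \<gamma>) * (\<Sum>t<k. F (X t) \<bullet> (sketch_H F (S t) (X t) *v F (X t)))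
    \<le> (norm (x0 - xs))\<^sup>2"
proof (induction k)
  case (Suc k)
  have "(norm (X (Suc k) - xs))\<^sup>2 + \<gamma> * (1 - \<gamma>) * (F (X k) \<bullet> (sketch_H F (S k) (X k) *v F (X k)))
      \<le> (norm (X k - xs))\<^sup>2"
    unfolding X_def SNR_iter_Suc Let_def
    using convex[of k] by (intro SNR_step_descent F \<gamma>) (simp add: Let_def)
  with Suc.IH show ?case by (simp add: distrib_left)
qed (simp add: X_def)

lemma SNR_rate:
  fixes D :: "real ^ 'p \<Rightarrow> (real ^ 't ^ 'm) measure"
    and S :: "nat \<Rightarrow> 'w \<Rightarrow> real ^ 't ^ 'm"
  assumes F: "continuously_differentiable F" "F xs = 0"
    and int: "\<And>x. sketch_integrable F D x"
    and F_col: "\<And>x. F x \<in> col_space (transpose (DF F x))"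
    and nz: "\<And>x. norm (x - xs) \<le> norm (x0 - xs) \<Longrightarrow> col_space (DF F x) \<noteq> {0}"
    and L: "\<And>x. norm (x - xs) \<le> norm (x0 - xs) \<Longrightarrow> onorm ((*v) (DF F x)) \<le> L" "0 < L"
    and r: "\<And>x. norm (x - xs) \<le> norm (x0 - xs) \<Longrightarrow> r \<le> rho_at F D x" "0 < r"
    and S: "SNR_sketches F D \<gamma> x0 M S" and \<gamma>: "0 < \<gamma>" "\<gamma> < 1"
    and convex: "AE \<omega> in M. \<forall>k.
          let x = SNR_iter F \<gamma> x0 (\<lambda>j. S j \<omega>) k; f = sketched_obj F (S k \<omega>) x
          in f xs \<ge> f x + grad f x \<bullet> (xs - x)"
    and k: "1 \<le> k"
  defines "m \<equiv> \<lambda>\<omega>. MIN t \<in> {..<k}. (norm (F (SNR_iter F \<gamma> x0 (\<lambda>j. S j \<omega>) t)))\<^sup>2"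
  shows "integrable M m"
    and "(\<integral>\<omega>. m \<omega> \<partial>M) \<le> 1 / real k * (L\<^sup>2 * (norm (x0 - xs))\<^sup>2 / (r * \<gamma> * (1 - \<gamma>)))"
proof -
  define X where "X t \<omega> = SNR_iter F \<gamma> x0 (\<lambda>j. S j \<omega>) t" for t \<omega>
  define a where "a t \<omega> = (norm (F (X t \<omega>)))\<^sup>2" for t \<omega>
  define h where "h z = F (fst z) \<bullet> (sketch_H F (snd z) (fst z) *v F (fst z))"
    for z :: "(real ^ 'p) \<times> (real ^ 't ^ 'm)"
  \<comment> \<open>\<open>R\<close> bounds the accumulated forms along almost every path;
    \<open>\<kappa>\<close> is the factor by which the averaged form dominates the squared residual
    on the ball.\<close>
  define R where "R = (norm (x0 - xs))\<^sup>2 / (\<gamma> * (1 - \<gamma>))"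
  define \<kappa> where "\<kappa> = r / L\<^sup>2"
  have pos: "0 < \<gamma> * (1 - \<gamma>)" "0 < \<kappa>" "0 \<le> R"
    using \<gamma> r(2) L(2) by (simp_all add: \<kappa>_def R_def)
  have h_nonneg: "0 \<le> h z" for z by (simp add: h_def sketch_H_form_nonneg)
  interpret prob_space M using S by (simp add: SNR_sketches_def)
  have Sm[measurable]: "S t \<in> borel_measurable M" for t using S by (simp add: SNR_sketches_def)
  have Xm[measurable]: "X t \<in> borel_measurable M" for t
    unfolding X_def by (intro borel_measurable_SNR_iter F Sm)
  have Fm[measurable]: "F \<in> borel_measurable borel"
    by (intro borel_measurable_continuous_onI continuously_differentiable_imp_continuous_on F)
  have hm[measurable]: "h \<in> borel_measurable (borel \<Otimes>\<^sub>M borel)"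
    unfolding h_def by (rule borel_measurable_sketched_residual_form[OF F(1)])
  have am[measurable]: "a t \<in> borel_measurable M" for t
    unfolding a_def by measurable
  have m_eq: "m \<omega> = (MIN t \<in> {..<k}. a t \<omega>)" for \<omega> by (simp add: m_def a_def X_def)
  have mm[measurable]: "m \<in> borel_measurable M"
    unfolding m_eq[abs_def] using k by (intro borel_measurable_Min) (auto simp: lessThan_empty_iff)
  have m_le: "m \<omega> \<le> a t \<omega>" if "t < k" for t \<omega>
    unfolding m_eq using that by (intro Min_le) auto
  have m_nonneg: "0 \<le> m \<omega>" for \<omega>
  proof -
    have "m \<omega> \<in> (\<lambda>t. a t \<omega>) ` {..<k}"
      unfolding m_eq using k by (intro Min_in) (auto simp: lessThan_empty_iff)
    then show ?thesis by (auto simp: a_def)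
  qed
  have descent: "AE \<omega> in M. \<forall>k. (norm (X k \<omega> - xs))\<^sup>2 + \<gamma> * (1 - \<gamma>) * (\<Sum>t<k. h (X t \<omega>, S t \<omega>)) \<le> (norm (x0 - xs))\<^sup>2"
    using convex
  proof eventually_elim
    case (elim \<omega>)
    then show ?case
      unfolding X_def h_def fst_conv snd_conv by (intro allI SNR_descent F \<gamma>) blast
  qed
  have ball: "AE \<omega> in M. \<forall>t. norm (X t \<omega> - xs) \<le> norm (x0 - xs)"
    using descent
  proof eventually_elim
    case (elim \<omega>)
    show ?case
    proof
      fix t
      have "0 \<le> \<gamma> * (1 - \<gamma>) * (\<Sum>t<t. h (X t \<omega>, S t \<omega>))"
        by (intro mult_nonneg_nonneg[OF less_imp_le[OF pos(1)]] sum_nonneg h_nonneg)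
      then have "(norm (X t \<omega> - xs))\<^sup>2 \<le> (norm (x0 - xs))\<^sup>2"
        using elim[rule_format, of t] by linarith
      then show "norm (X t \<omega> - xs) \<le> norm (x0 - xs)" by (rule power2_le_imp_le) simp
    qed
  qed
  \<comment> \<open>Conditioning on the past replaces the random sketch by its mean, and the iterate
    lies almost surely in the ball where \<open>r\<close> and \<open>L\<close> are valid
    bounds.\<close>
  have step: "(\<integral>\<^sup>+\<omega>. ennreal (\<kappa> * a t \<omega>) \<partial>M) \<le> (\<integral>\<^sup>+\<omega>. ennreal (h (X t \<omega>, S t \<omega>)) \<partial>M)" for t
  proof -
    have "AE \<omega> in M. ennreal (\<kappa> * a t \<omega>) \<le> (\<integral>\<^sup>+s. ennreal (h (X t \<omega>, s)) \<partial>D (X t \<omega>))"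
      using ball
    proof eventually_elim
      case (elim \<omega>)
      define x where "x = X t \<omega>"
      have x: "norm (x - xs) \<le> norm (x0 - xs)" using elim by (simp add: x_def)
      have "r * (norm (F x))\<^sup>2 \<le> rho_at F D x * (norm (F x))\<^sup>2"
        by (intro mult_right_mono r(1) x) simp
      also have "\<dots> \<le> L\<^sup>2 * (F x \<bullet> (expected_H F D x *v F x))"
        by (intro expected_sketched_residual_ge int nz F_col L x)
      finally have "\<kappa> * a t \<omega> \<le> F x \<bullet> (expected_H F D x *v F x)"
        using L(2) by (simp add: \<kappa>_def a_def x_def field_simps)
      also have "\<dots> = (\<integral>s. h (x, s) \<partial>D x)" by (simp add: expected_H_form[OF int] h_def)
      finally have "ennreal (\<kappa> * a t \<omega>) \<le> ennreal (\<integral>s. h (x, s) \<partial>D x)" by (rule ennreal_leI)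
      also have "\<dots> = (\<integral>\<^sup>+s. ennreal (h (x, s)) \<partial>D x)"
        using integrable_sketch_H_form[OF int, of x "F x" "F x"]
        by (intro nn_integral_eq_integral[symmetric]) (auto simp: h_nonneg, simp add: h_def)
      finally show ?case by (simp add: x_def)
    qed
    then have "(\<integral>\<^sup>+\<omega>. ennreal (\<kappa> * a t \<omega>) \<partial>M) \<le> (\<integral>\<^sup>+\<omega>. (\<integral>\<^sup>+s. ennreal (h (X t \<omega>, s)) \<partial>D (X t \<omega>)) \<partial>M)"
      by (rule nn_integral_mono_AE)
    also have "\<dots> = (\<integral>\<^sup>+\<omega>. ennreal (h (X t \<omega>, S t \<omega>)) \<partial>M)"
      unfolding X_def using nn_integral_SNR_sketch[OF F(1) S, of "\<lambda>z. ennreal (h z)"] by simp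
    finally show ?thesis .
  qed
  \<comment> \<open>The minimum is at most each of the \<open>k\<close> terms, hence
    \<open>k\<close> times it is at most their sum. The chain uses nonnegative integrals, so its
    finite bound also yields integrability of \<open>m\<close>.\<close>
  have "(\<integral>\<^sup>+\<omega>. ennreal (real k * \<kappa> * m \<omega>) \<partial>M) \<le> (\<integral>\<^sup>+\<omega>. (\<Sum>t<k. ennreal (\<kappa> * a t \<omega>)) \<partial>M)"
  proof (rule nn_integral_mono)
    fix \<omega>
    have "real k * \<kappa> * m \<omega> = (\<Sum>t<k. \<kappa> * m \<omega>)" by simp
    also have "\<dots> \<le> (\<Sum>t<k. \<kappa> * a t \<omega>)"
      using pos(2) m_le by (intro sum_mono mult_left_mono) auto
    finally show "ennreal (real k * \<kappa> * m \<omega>) \<le> (\<Sum>t<k. ennreal (\<kappa> * a t \<omega>))"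
      using pos(2) by (simp add: sum_ennreal a_def ennreal_leI)
  qed
  also have "\<dots> = (\<Sum>t<k. \<integral>\<^sup>+\<omega>. ennreal (\<kappa> * a t \<omega>) \<partial>M)"
    by (intro nn_integral_sum) measurable
  also have "\<dots> \<le> (\<Sum>t<k. \<integral>\<^sup>+\<omega>. ennreal (h (X t \<omega>, S t \<omega>)) \<partial>M)"
    by (intro sum_mono step)
  also have "\<dots> = (\<integral>\<^sup>+\<omega>. (\<Sum>t<k. ennreal (h (X t \<omega>, S t \<omega>))) \<partial>M)"
    by (intro nn_integral_sum[symmetric]) measurable
  also have "\<dots> \<le> (\<integral>\<^sup>+\<omega>. ennreal R \<partial>M)"
  proof (rule nn_integral_mono_AE)
    show "AE \<omega> in M. (\<Sum>t<k. ennreal (h (X t \<omega>, S t \<omega>))) \<le> ennreal R"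
      using descent
    proof eventually_elim
      case (elim \<omega>)
      then have "\<gamma> * (1 - \<gamma>) * (\<Sum>t<k. h (X t \<omega>, S t \<omega>)) \<le> (norm (x0 - xs))\<^sup>2"
        using zero_le_power2[of "norm (X k \<omega> - xs)"] by (smt (verit))
      then have "(\<Sum>t<k. h (X t \<omega>, S t \<omega>)) \<le> R"
        using pos(1) by (simp add: R_def pos_le_divide_eq mult.commute)
      then show ?case by (simp add: sum_ennreal h_nonneg ennreal_leI)
    qed
  qed
  also have "\<dots> = ennreal R" by (simp add: emeasure_space_1)
  finally have bound: "(\<integral>\<^sup>+\<omega>. ennreal (real k * \<kappa> * m \<omega>) \<partial>M) \<le> ennreal R" .
  have k\<kappa>: "0 < real k * \<kappa>" using k pos(2) by simp
  have int_km: "integrable M (\<lambda>\<omega>. real k * \<kappa> * m \<omega>)"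
  proof (rule integrableI_nonneg)
    show "(\<integral>\<^sup>+\<omega>. ennreal (real k * \<kappa> * m \<omega>) \<partial>M) < \<infinity>"
      using bound by (rule le_less_trans) simp
    show "AE \<omega> in M. 0 \<le> real k * \<kappa> * m \<omega>"
      by (intro AE_I2 mult_nonneg_nonneg[OF less_imp_le[OF k\<kappa>]] m_nonneg)
  qed measurable
  then have "integrable M (\<lambda>\<omega>. (1 / (real k * \<kappa>)) * (real k * \<kappa> * m \<omega>))"
    by (rule integrable_mult_right)
  moreover have "k \<noteq> 0" "\<kappa> \<noteq> 0" using k pos(2) by auto
  ultimately show "integrable M m" by simp
  have "ennreal (\<integral>\<omega>. real k * \<kappa> * m \<omega> \<partial>M) \<le> ennreal R"
    using bound nn_integral_eq_integral[OF int_km AE_I2[OF mult_nonneg_nonneg[OF less_imp_le[OF k\<kappa>] m_nonneg]]]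
    by simp
  then have "real k * \<kappa> * (\<integral>\<omega>. m \<omega> \<partial>M) \<le> R"
    using pos(3) by simp
  then have "(\<integral>\<omega>. m \<omega> \<partial>M) \<le> R / (real k * \<kappa>)"
    using k\<kappa> by (simp add: pos_le_divide_eq mult.commute)
  also have "\<dots> = 1 / real k * (L\<^sup>2 * (norm (x0 - xs))\<^sup>2 / (r * \<gamma> * (1 - \<gamma>)))"
    by (simp add: R_def \<kappa>_def mult_ac)
  finally show "(\<integral>\<omega>. m \<omega> \<partial>M) \<le> 1 / real k * (L\<^sup>2 * (norm (x0 - xs))\<^sup>2 / (r * \<gamma> * (1 - \<gamma>)))" .
qed

theorem corollary4p5:
  fixes F :: "real ^ 'p \<Rightarrow> real ^ 'm"
    and D :: "real ^ 'p \<Rightarrow> (real ^ 't ^ 'm) measure"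
    and xs x0 :: "real ^ 'p"
    and L \<gamma> :: real
    and M :: "'w measure"
    and S :: "nat \<Rightarrow> 'w \<Rightarrow> real ^ 't ^ 'm"
  assumes F_C1: "continuously_differentiable F"
    and D_distribution: "\<forall>x. prob_space (D x) \<and> sets (D x) = sets borel"
    and expected_H_finite: "\<forall>x. integrable (D x) (\<lambda>S. sketch_H F S x)"
    and root: "F xs = 0"
    and L_def: "L = (SUP x \<in> {x. norm (x - xs) \<le> norm (x0 - xs)}. onorm ((*v) (DF F x)))"
    and L_pos: "L > 0"
    and col_space_nontrivial: "\<forall>x. norm (x - xs) \<le> norm (x0 - xs) \<longrightarrow> col_space (DF F x) \<noteq> {0}"
    and rho_exists: "\<exists>x. norm (x - xs) \<le> norm (x0 - xs) \<and>
        (\<forall>y. norm (y - xs) \<le> norm (x0 - xs) \<longrightarrow> rho_at F D x \<le> rho_at F D y)"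
  shows "(\<forall>x. col_space (DF F x) \<noteq> {0} \<longrightarrow> 0 \<le> rho_at F D x \<and> rho_at F D x \<le> 1) \<and>
    ((\<forall>x. F x \<in> col_space (transpose (DF F x)) \<and> col_space (transpose (DF F x)) \<subseteq> col_space (expected_H F D x)) \<longrightarrow>
      (\<forall>x. col_space (DF F x) \<noteq> {0} \<longrightarrow>
        rho_at F D x = lambda_min_pos (DF F x ** expected_H F D x ** transpose (DF F x)) \<and>
        lambda_min_pos (DF F x ** expected_H F D x ** transpose (DF F x)) > 0) \<and>
      rho F D xs x0 > 0 \<and>
      (SNR_sketches F D \<gamma> x0 M S \<and> 0 < \<gamma> \<and> \<gamma> < 1 \<and>
       (AE \<omega> in M. \<forall>k.
          let x = SNR_iter F \<gamma> x0 (\<lambda>j. S j \<omega>) k; f = sketched_obj F (S k \<omega>) x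
          in f xs \<ge> f x + grad f x \<bullet> (xs - x)) \<longrightarrow>
        (\<forall>k \<ge> 1.
          integrable M (\<lambda>\<omega>. MIN t \<in> {..<k}. (norm (F (SNR_iter F \<gamma> x0 (\<lambda>j. S j \<omega>) t)))\<^sup>2) \<and>
          (\<integral>\<omega>. (MIN t \<in> {..<k}. (norm (F (SNR_iter F \<gamma> x0 (\<lambda>j. S j \<omega>) t)))\<^sup>2) \<partial>M)
            \<le> 1 / real k * (L\<^sup>2 * (norm (x0 - xs))\<^sup>2 / (rho F D xs x0 * \<gamma> * (1 - \<gamma>))))))"
proof -
  have int: "sketch_integrable F D x" for x
    using expected_H_finite by (simp add: sketch_integrable_def)
  have prob: "prob_space (D x)" for x using D_distribution by blast
  \<comment> \<open>A minimiser \<open>y\<close> in the ball turns the \<open>LEAST\<close> in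
    \<open>rho\<close> into \<open>rho_at F D y\<close>; positivity of \<open>rho\<close> is then
    positivity at one point.\<close>
  obtain y where y: "norm (y - xs) \<le> norm (x0 - xs)"
      "\<And>z. norm (z - xs) \<le> norm (x0 - xs) \<Longrightarrow> rho_at F D y \<le> rho_at F D z"
    using rho_exists by blast
  have rho: "rho F D xs x0 = rho_at F D y"
    unfolding rho_def by (rule Least_equality) (use y in auto)
  have nz: "norm (x - xs) \<le> norm (x0 - xs) \<Longrightarrow> col_space (DF F x) \<noteq> {0}" for x
    using col_space_nontrivial by blast
  have L: "norm (x - xs) \<le> norm (x0 - xs) \<Longrightarrow> onorm ((*v) (DF F x)) \<le> L" for x
    unfolding L_def by (rule onorm_DF_le_SUP[OF F_C1])
  have rho_le: "norm (x - xs) \<le> norm (x0 - xs) \<Longrightarrow> rho F D xs x0 \<le> rho_at F D x" for x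
    unfolding rho by (rule y(2))
  show ?thesis
    unfolding avg_proj_def[symmetric]
  proof (intro conjI impI allI; (elim conjE)?)
    fix x assume x: "col_space (DF F x) \<noteq> {0}"
    show "0 \<le> rho_at F D x" by (rule rho_at_nonneg[OF int x])
    show "rho_at F D x \<le> 1" by (rule rho_at_le_1[OF prob int x])
  next
    assume im: "\<forall>x. F x \<in> col_space (transpose (DF F x)) \<and>
      col_space (transpose (DF F x)) \<subseteq> col_space (expected_H F D x)"
    then have F_col: "F x \<in> col_space (transpose (DF F x))"
      and sub: "col_space (transpose (DF F x)) \<subseteq> col_space (expected_H F D x)" for x by auto
    show pos: "rho F D xs x0 > 0"
      unfolding rho by (rule rho_at_pos[OF int nz[OF y(1)] sub])
    {
      fix x assume x: "col_space (DF F x) \<noteq> {0}"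
      show "rho_at F D x = lambda_min_pos (avg_proj F D x)" "lambda_min_pos (avg_proj F D x) > 0"
        using rho_at_eq_lambda_min_pos[OF int x sub] rho_at_pos[OF int x sub] by simp_all
    }
    fix k :: nat
    assume "SNR_sketches F D \<gamma> x0 M S" "0 < \<gamma>" "\<gamma> < 1" "1 \<le> k"
      "AE \<omega> in M. \<forall>k. let x = SNR_iter F \<gamma> x0 (\<lambda>j. S j \<omega>) k; f = sketched_obj F (S k \<omega>) x
          in f xs \<ge> f x + grad f x \<bullet> (xs - x)"
    note rate = SNR_rate[OF F_C1 root int F_col nz L L_pos rho_le pos this(1,2,3,5,4)]
    show "integrable M (\<lambda>\<omega>. MIN t \<in> {..<k}. (norm (F (SNR_iter F \<gamma> x0 (\<lambda>j. S j \<omega>) t)))\<^sup>2)"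
      by (rule rate(1))
    show "(\<integral>\<omega>. (MIN t \<in> {..<k}. (norm (F (SNR_iter F \<gamma> x0 (\<lambda>j. S j \<omega>) t)))\<^sup>2) \<partial>M)
        \<le> 1 / real k * (L\<^sup>2 * (norm (x0 - xs))\<^sup>2 / (rho F D xs x0 * \<gamma> * (1 - \<gamma>)))"
      by (rule rate(2))
  qed
qed

end
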